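(* Let $G_0=B_4/Z$, let $G_1=\langle a,y\rangle\le G_0$, and let $X_1$ be the 2-dimensional complex with its geometric action of $G_1$ (all as defined in the context). There do not exist a CAT(0) space $X$ of covering dimension 2, on which $G_0$ admits a proper action by semisimple isometries, and a $G_1$-equivariant map $f_1\colon X_1\to X$, where $G_1$ acts geometrically on $X$ as a subgroup of $G_0$ (i.e. by restriction of the action of $G_0$), such that $f_1$ is locally injective, and locally isometric (up to scaling) outside of the 0-skeleton of $X_1$.
   Context: The groups. $B_4=\langle a,b,c\mid aba=bab,\ bcb=cbc,\ ac=ca\rangle$ is the braid group on 4 strings, $Z$ its (infinite cyclic) center, $G_0:=B_4/Z$. Put $e=a^{-1}ba$, $x=bac$, $y=xc$, $\hat b=c^{-2}bc^2$; the center $Z$ is generated by $x^4=y^3$. The same letters denote elements of $B_4$ and their images in $G_0$. Conjugation by $y$ sends $a\mapsto e\mapsto\hat b\mapsto a$, i.e. $yay^{-1}=e$, $yey^{-1}=\hat b$, $y\hat by^{-1}=a$. Let $G_1:=\langle a,y\rangle\le G_0$ (a subgroup of finite index); it contains $e$, $\hat b$ and $b=e^{-1}ae$. The complex $X_1$. Let $\overline Y_1$ be the 2-complex with one vertex, four oriented loops labeled $a,e,b,t_1$, and three triangles glued along the loops according to the relations $ae=t_1$, $eb=t_1$, $ba=t_1$; each triangle is a Euclidean equilateral triangle of side 1. Its fundamental group is $B_1=\langle a,e,b\mid ae=eb=ba\rangle$. Let $\overline Y_2$ be the copy of $\overline Y_1$ in which the loops $a,e,b,t_1$ are relabeled $e,\hat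 b,b_2,t_2$ (so the triangles read $e\hat b=t_2$, $\hat bb_2=t_2$, $b_2e=t_2$), and $\overline Y_3$ the copy in which they are relabeled $\hat b,a,b_3,t_3$ (so the triangles read $\hat ba=t_3$, $ab_3=t_3$, $b_3\hat b=t_3$); here $b_2,b_3$ correspond to $yby^{-1},y^2by^{-2}$, so that $\overline Y_2,\overline Y_3$ correspond to the subgroups $yB_1y^{-1}$, $y^2B_1y^{-2}$ of $G_1$. Let $K$ be the space obtained by identifying $\overline Y_1,\overline Y_2,\overline Y_3$ along their common labeled oriented loops: $e$ in $\overline Y_1$ and $\overline Y_2$, $\hat b$ in $\overline Y_2$ and $\overline Y_3$, $a$ in $\overline Y_3$ and $\overline Y_1$ (so $K$ has one vertex). $X_1$ is the universal cover of $K$, with the induced length metric; it is CAT(0). The group $G_1$ acts geometrically on $X_1$ as follows: fixing a base vertex $\tilde v$ of $X_1$, the elements $a,e,\hat b\in G_1$ act as the deck transformations corresponding to the loops with the same label, and $y$ acts as the lift fixing $\tilde v$ of the order 3 isometry of $K$ induced by the relabelings $\overline Y_1\to\overline Y_2\to\overline Y_3\to\overline Y_1$ (sending loops $a\mapsto e\mapsto\hat b\mapsto a$). An action is geometric if it is isometric, properly discontinuous and cocompact. An isometry $g$ is semisimple if $p\mapsto d(p,gp)$ attains its infimum. Locally isometric up to scaling on a subset $U$ means: there is a constant $\lambda>0$ such that every point of $U$ has a neighborhood on which $d(f_1(p),f_1(q))=\lambda\, d(p,q)$. Locally injective means every point of the domain has a neighborhood on which $f_1$ is injective. *)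

theory Defs
  imports "HOL-Analysis.Analysis" "HOL-Algebra.Generated_Groups" "HOL-Algebra.Group_Action"
begin

section \<open>The groups\<close>

text \<open>Words in generators and their formal inverses: \<open>(g, True)\<close> stands for \<open>g\<close> and
  \<open>(g, False)\<close> for its inverse. All elements of the type \<open>'g\<close> are generators.\<close>

type_synonym 'g word = "('g \<times> bool) list"

inductive word_eq :: "('g word \<times> 'g word) set \<Rightarrow> 'g word \<Rightarrow> 'g word \<Rightarrow> bool"
  for R where
  refl: "word_eq R u u"
| sym: "word_eq R u v \<Longrightarrow> word_eq R v u"
| trans: "word_eq R u v \<Longrightarrow> word_eq R v w \<Longrightarrow> word_eq R u w"
| append: "word_eq R u u' \<Longrightarrow> word_eq R v v' \<Longrightarrow> word_eq R (u @ v) (u' @ v')"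
| cancel: "word_eq R [(g, s), (g, \<not> s)] []"
| relation: "(u, v) \<in> R \<Longrightarrow> word_eq R u v"

definition presented_group :: "('g word \<times> 'g word) set \<Rightarrow> 'g word set monoid" where
  "presented_group R =
     \<lparr>carrier = UNIV // {(u, v). word_eq R u v},
      monoid.mult = (\<lambda>U V. \<Union>u\<in>U. \<Union>v\<in>V. {w. word_eq R (u @ v) w}),
      one = {w. word_eq R [] w}\<rparr>"

lemma word_eq_class_eq: "{w. word_eq R u w} = {w. word_eq R v w} \<longleftrightarrow> word_eq R u v"
  by (metis (mono_tags, lifting) Collect_cong mem_Collect_eq word_eq.refl word_eq.sym word_eq.trans)

lemma carrier_presented_group:
  "carrier (presented_group R) = range (\<lambda>u. {w. word_eq R u w})"
  by (auto simp: presented_group_def quotient_def Image_def)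

lemma mult_presented_group:
  "{w. word_eq R u w} \<otimes>\<^bsub>presented_group R\<^esub> {w. word_eq R v w} = {w. word_eq R (u @ v) w}"
proof -
  have "word_eq R (u' @ v') w \<longleftrightarrow> word_eq R (u @ v) w" if "word_eq R u u'" "word_eq R v v'" for u' v' w
    using word_eq.append[OF that] word_eq.trans word_eq.sym by metis
  then show ?thesis
    by (auto simp: presented_group_def intro: word_eq.refl)
qed

lemma group_presented_group: "group (presented_group R)"
proof (rule groupI)
  define cls where "cls u = {w. word_eq R u w}" for u
  have car: "carrier (presented_group R) = range cls"
    by (simp add: carrier_presented_group cls_def)
  have mult: "cls u \<otimes>\<^bsub>presented_group R\<^esub> cls v = cls (u @ v)" for u v
    by (simp add: mult_presented_group cls_def)
  have one: "\<one>\<^bsub>presented_group R\<^esub> = cls []"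
    by (simp add: presented_group_def cls_def)
  let ?G = "presented_group R"
  show "x \<otimes>\<^bsub>?G\<^esub> y \<in> carrier ?G" if "x \<in> carrier ?G" "y \<in> carrier ?G" for x y
    using that by (auto simp: car mult)
  show "\<one>\<^bsub>?G\<^esub> \<in> carrier ?G"
    by (simp add: car one)
  show "x \<otimes>\<^bsub>?G\<^esub> y \<otimes>\<^bsub>?G\<^esub> z = x \<otimes>\<^bsub>?G\<^esub> (y \<otimes>\<^bsub>?G\<^esub> z)"
    if "x \<in> carrier ?G" "y \<in> carrier ?G" "z \<in> carrier ?G" for x y z
    using that by (auto simp: car mult)
  show "\<one>\<^bsub>?G\<^esub> \<otimes>\<^bsub>?G\<^esub> x = x" if "x \<in> carrier ?G" for x
    using that by (auto simp: car one mult)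
  have inv: "\<exists>v. word_eq R (v @ u) []" for u
  proof (induction u)
    case Nil
    show ?case by (rule exI[of _ "[]"]) (simp add: word_eq.refl)
  next
    case (Cons x u)
    obtain g s where x: "x = (g, s)" by (cases x)
    from Cons.IH obtain v where v: "word_eq R (v @ u) []" by blast
    have c: "word_eq R [(g, \<not> s), (g, s)] []"
      using word_eq.cancel[of R g "\<not> s"] by simp
    have "word_eq R (v @ [(g, \<not> s), (g, s)] @ u) (v @ [] @ u)"
      by (intro word_eq.append word_eq.refl c)
    then have "word_eq R ((v @ [(g, \<not> s)]) @ x # u) []"
      using word_eq.trans[of R _ "v @ u" "[]"] v by (simp add: x)
    then show ?case by blast
  qed
  show "\<exists>y\<in>carrier ?G. y \<otimes>\<^bsub>?G\<^esub> x = \<one>\<^bsub>?G\<^esub>" if xc: "x \<in> carrier ?G" for x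
  proof -
    from xc obtain u where u: "x = cls u" by (auto simp: car)
    from inv obtain v where "word_eq R (v @ u) []" by blast
    then have "cls v \<otimes>\<^bsub>?G\<^esub> x = \<one>\<^bsub>?G\<^esub>"
      by (simp add: u mult one) (simp add: cls_def word_eq_class_eq)
    then show ?thesis by (auto simp: car)
  qed
qed

definition group_center :: "('a, 'b) monoid_scheme \<Rightarrow> 'a set" where
  "group_center G = {z \<in> carrier G. \<forall>g\<in>carrier G. g \<otimes>\<^bsub>G\<^esub> z = z \<otimes>\<^bsub>G\<^esub> g}"

lemma (in group) group_center_normal: "group_center G \<lhd> G"
proof -
  have "subgroup (group_center G) G"
  proof (rule subgroupI)
    show "group_center G \<subseteq> carrier G" unfolding group_center_def by blast
    show "group_center G \<noteq> {}" unfolding group_center_def by (simp add: ex_in_conv[symmetric]) (metis one_closed l_one r_one)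
    show "inv z \<in> group_center G" if "z \<in> group_center G" for z
    proof -
      have z: "z \<in> carrier G" and comm: "\<And>g. g \<in> carrier G \<Longrightarrow> g \<otimes> z = z \<otimes> g"
        using that unfolding group_center_def by blast+
      have "g \<otimes> inv z = inv z \<otimes> g" if g: "g \<in> carrier G" for g
      proof -
        have "inv (inv g \<otimes> z) = inv (z \<otimes> inv g)" using comm[of "inv g"] g by simp
        moreover have "inv (inv g \<otimes> z) = inv z \<otimes> g" "inv (z \<otimes> inv g) = g \<otimes> inv z"
          using z g by (simp_all add: inv_mult_group)
        ultimately show ?thesis by (simp only:)
      qed
      then show ?thesis using z by (simp add: group_center_def)
    qed
    show "z \<otimes> w \<in> group_center G" if "z \<in> group_center G" "w \<in> group_center G" for z w
    proof -
      have z: "z \<in> carrier G" "\<And>g. g \<in> carrier G \<Longrightarrow> g \<otimes> z = z \<otimes> g"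
       and w: "w \<in> carrier G" "\<And>g. g \<in> carrier G \<Longrightarrow> g \<otimes> w = w \<otimes> g"
        using that unfolding group_center_def by blast+
      have "g \<otimes> (z \<otimes> w) = (z \<otimes> w) \<otimes> g" if g: "g \<in> carrier G" for g
      proof -
        have "g \<otimes> (z \<otimes> w) = (z \<otimes> g) \<otimes> w" using z(1) z(2)[OF g] w(1) g by (simp add: m_assoc[symmetric])
        also have "\<dots> = z \<otimes> (w \<otimes> g)" using z(1) w(1) w(2)[OF g] g by (simp add: m_assoc)
        also have "\<dots> = (z \<otimes> w) \<otimes> g" using z(1) w(1) g by (simp add: m_assoc)
        finally show ?thesis .
      qed
      then show ?thesis using z(1) w(1) by (simp add: group_center_def)
    qed
  qed
  then show ?thesis
  proof (rule normalI, intro ballI)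
    fix x assume x: "x \<in> carrier G"
    then show "group_center G #> x = x <# group_center G"
      unfolding r_coset_def l_coset_def by (intro SUP_cong) (auto simp only: group_center_def mem_Collect_eq)
  qed
qed

datatype braid_gen = Gen_a | Gen_b | Gen_c

definition B4 :: "braid_gen word set monoid" where
  "B4 = presented_group
     {([(Gen_a, True), (Gen_b, True), (Gen_a, True)], [(Gen_b, True), (Gen_a, True), (Gen_b, True)]),
      ([(Gen_b, True), (Gen_c, True), (Gen_b, True)], [(Gen_c, True), (Gen_b, True), (Gen_c, True)]),
      ([(Gen_a, True), (Gen_c, True)], [(Gen_c, True), (Gen_a, True)])}"

definition G0 :: "braid_gen word set set monoid" where
  "G0 = B4 Mod group_center B4"

lemma group_B4: "group B4"
  by (simp add: B4_def group_presented_group)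

lemma group_G0: "group G0"
  unfolding G0_def by (intro normal.factorgroup_is_group group.group_center_normal group_B4)

text \<open>The image in \<open>G0\<close> of the element of \<open>B4\<close> represented by a word.\<close>

definition G0_word :: "braid_gen word \<Rightarrow> braid_gen word set set" where
  "G0_word u = group_center B4 #>\<^bsub>B4\<^esub> (THE U. U \<in> carrier B4 \<and> u \<in> U)"

definition "G0_a = G0_word [(Gen_a, True)]"
definition "G0_b = G0_word [(Gen_b, True)]"
definition "G0_c = G0_word [(Gen_c, True)]"
definition "G0_e = inv\<^bsub>G0\<^esub> G0_a \<otimes>\<^bsub>G0\<^esub> G0_b \<otimes>\<^bsub>G0\<^esub> G0_a"
definition "G0_x = G0_b \<otimes>\<^bsub>G0\<^esub> G0_a \<otimes>\<^bsub>G0\<^esub> G0_c"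
definition "G0_y = G0_x \<otimes>\<^bsub>G0\<^esub> G0_c"
definition "G0_bhat =
  inv\<^bsub>G0\<^esub> (G0_c [^]\<^bsub>G0\<^esub> (2::nat)) \<otimes>\<^bsub>G0\<^esub> G0_b \<otimes>\<^bsub>G0\<^esub> G0_c [^]\<^bsub>G0\<^esub> (2::nat)"

definition G1 :: "braid_gen word set set monoid" where
  "G1 = subgroup_generated G0 {G0_a, G0_y}"

lemma ex1_class: "\<exists>!U. U \<in> carrier (presented_group R) \<and> u \<in> U"
proof (rule ex1I[of _ "{w. word_eq R u w}"])
  show "{w. word_eq R u w} \<in> carrier (presented_group R) \<and> u \<in> {w. word_eq R u w}"
    by (simp add: carrier_presented_group word_eq.refl)
  fix U assume "U \<in> carrier (presented_group R) \<and> u \<in> U"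
  then obtain v where "U = {w. word_eq R v w}" "word_eq R v u"
    by (auto simp: carrier_presented_group)
  then show "U = {w. word_eq R u w}"
    by (simp add: word_eq_class_eq)
qed

lemma G0_word_closed: "G0_word u \<in> carrier G0"
proof -
  have "(THE U. U \<in> carrier B4 \<and> u \<in> U) \<in> carrier B4"
    using theI'[OF ex1_class[of _ u]] unfolding B4_def by blast
  then show ?thesis
    by (auto simp: G0_word_def G0_def FactGroup_def RCOSETS_def)
qed

section \<open>The complex K\<close>

datatype loop_label = La | Le | Lbhat | Lb | Lb2 | Lb3 | Lt1 | Lt2 | Lt3

text \<open>The triple \<open>(u, v, w)\<close> is the triangle with boundary relation \<open>u v = w\<close>. It is modelled on the
  equilateral triangle with corners \<open>0\<close>, \<open>1\<close>, \<open>cis (pi / 3)\<close>: the side \<open>u\<close> runs from the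
  first to the second corner, \<open>v\<close> from the second to the third, \<open>w\<close> from the first to the third.\<close>

type_synonym triangle = "loop_label \<times> loop_label \<times> loop_label"

definition std_triangle :: "complex set" where
  "std_triangle = convex hull {0, 1, cis (pi / 3)}"

fun sides :: "triangle \<Rightarrow> (loop_label \<times> (real \<Rightarrow> complex)) set" where
  "sides (u, v, w) =
     {(u, linepath 0 1), (v, linepath 1 (cis (pi / 3))), (w, linepath 0 (cis (pi / 3)))}"

definition Y_triangles :: "loop_label \<Rightarrow> loop_label \<Rightarrow> loop_label \<Rightarrow> loop_label \<Rightarrow> triangle set" where
  "Y_triangles a e b t = {(a, e, t), (e, b, t), (b, a, t)}"

definition K_triangles :: "triangle set" where
  "K_triangles = Y_triangles La Le Lb Lt1 \<union> Y_triangles Le Lbhat Lb2 Lt2 \<union> Y_triangles Lbhat La Lb3 Lt3"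

text \<open>Sides with equal labels are glued, within each of the three copies and between them.
  The generated equivalence relation identifies all corners (see \<open>K_single_vertex\<close> below).\<close>

definition glue_sides :: "((triangle \<times> complex) \<times> (triangle \<times> complex)) set" where
  "glue_sides = {((\<tau>, g s), (\<tau>', g' s)) | \<tau> \<tau>' l g g' s.
     \<tau> \<in> K_triangles \<and> \<tau>' \<in> K_triangles \<and> (l, g) \<in> sides \<tau> \<and> (l, g') \<in> sides \<tau>' \<and> s \<in> {0..1}}"

definition glue :: "((triangle \<times> complex) \<times> (triangle \<times> complex)) set" where
  "glue = Restr (glue_sides\<^sup>*) (K_triangles \<times> std_triangle)"

lemma equiv_glue: "equiv (K_triangles \<times> std_triangle) glue"
proof (rule equivI)
  have "sym glue_sides"
    unfolding glue_sides_def by (rule symI) blast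
  then have "sym (glue_sides\<^sup>*)" by (rule sym_rtrancl)
  then show "sym glue"
    unfolding glue_def sym_def by blast
  show "refl_on (K_triangles \<times> std_triangle) glue"
    unfolding glue_def refl_on_def by blast
  show "trans glue"
    unfolding glue_def trans_def by (blast intro: rtrancl_trans)
  show "glue \<subseteq> (K_triangles \<times> std_triangle) \<times> (K_triangles \<times> std_triangle)"
    unfolding glue_def by blast
qed

lemma zero_in_std_triangle: "0 \<in> std_triangle"
  by (simp add: std_triangle_def hull_inc)

lemma side_in_std_triangle: "(l, g) \<in> sides \<tau> \<Longrightarrow> s \<in> {0..1} \<Longrightarrow> g s \<in> std_triangle"
proof -
  have *: "linepath p q s \<in> std_triangle"
    if "p \<in> {0, 1, cis (pi / 3)}" "q \<in> {0, 1, cis (pi / 3)}" "s \<in> {0..1}" for p q s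
    unfolding std_triangle_def
  proof (rule subsetD[OF hull_mono[of "{p, q}"]])
    show "{p, q} \<subseteq> {0, 1, cis (pi / 3)}" using that by blast
    show "linepath p q s \<in> convex hull {p, q}"
      using that(3) linepath_in_path[of s p q] by (simp add: segment_convex_hull)
  qed
  show "(l, g) \<in> sides \<tau> \<Longrightarrow> s \<in> {0..1} \<Longrightarrow> g s \<in> std_triangle"
  proof -
    assume "(l, g) \<in> sides \<tau>" and s: "s \<in> {0..1}"
    then consider "g = linepath 0 1" | "g = linepath 1 (cis (pi / 3))" | "g = linepath 0 (cis (pi / 3))"
      by (cases \<tau>) auto
    then show "g s \<in> std_triangle"
    proof cases
      case 1 show ?thesis unfolding 1 by (rule *) (use s in simp_all)
    next
      case 2 show ?thesis unfolding 2 by (rule *) (use s in simp_all)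
    next
      case 3 show ?thesis unfolding 3 by (rule *) (use s in simp_all)
    qed
  qed
qed

typedef K = "(K_triangles \<times> std_triangle) // glue"
proof -
  have "((La, Le, Lt1), 0) \<in> K_triangles \<times> std_triangle"
    by (simp add: K_triangles_def Y_triangles_def zero_in_std_triangle)
  then show ?thesis by (blast intro: quotientI)
qed

definition K_pt :: "triangle \<Rightarrow> complex \<Rightarrow> K" where
  "K_pt \<tau> z = Abs_K (glue `` {(\<tau>, z)})"

lemma K_pt_eq_iff:
  assumes "\<tau> \<in> K_triangles" "z \<in> std_triangle" "\<tau>' \<in> K_triangles" "z' \<in> std_triangle"
  shows "K_pt \<tau> z = K_pt \<tau>' z' \<longleftrightarrow> ((\<tau>, z), (\<tau>', z')) \<in> glue"
  using assms
  by (simp add: K_pt_def Abs_K_inject quotientI eq_equiv_class_iff[OF equiv_glue])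

lemma K_pt_cases:
  obtains \<tau> z where "\<tau> \<in> K_triangles" "z \<in> std_triangle" "P = K_pt \<tau> z"
proof (cases P)
  case (Abs_K C)
  from Abs_K(2) obtain \<tau> z where "\<tau> \<in> K_triangles" "z \<in> std_triangle" "C = glue `` {(\<tau>, z)}"
    by (elim quotientE SigmaE) blast
  then show thesis using that[of \<tau> z] Abs_K(1) by (simp add: K_pt_def)
qed

lemma K_pt_side:
  assumes "\<tau> \<in> K_triangles" "\<tau>' \<in> K_triangles" "(l, g) \<in> sides \<tau>" "(l, g') \<in> sides \<tau>'" "s \<in> {0..1}"
  shows "K_pt \<tau> (g s) = K_pt \<tau>' (g' s)"
proof -
  have "((\<tau>, g s), (\<tau>', g' s)) \<in> glue_sides"
    using assms unfolding glue_sides_def by blast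
  then show ?thesis
    using assms by (simp add: K_pt_eq_iff side_in_std_triangle glue_def r_into_rtrancl)
qed

instantiation K :: topological_space
begin

definition open_K :: "K set \<Rightarrow> bool" where
  "open_K U \<longleftrightarrow> (\<forall>\<tau>\<in>K_triangles. openin (top_of_set std_triangle) {z \<in> std_triangle. K_pt \<tau> z \<in> U})"

instance
proof
  show "open (UNIV :: K set)"
    by (simp add: open_K_def)
next
  fix S T :: "K set"
  assume "open S" "open T"
  moreover have "{z \<in> std_triangle. K_pt \<tau> z \<in> S \<inter> T} =
      {z \<in> std_triangle. K_pt \<tau> z \<in> S} \<inter> {z \<in> std_triangle. K_pt \<tau> z \<in> T}" for \<tau>
    by auto
  ultimately show "open (S \<inter> T)"
    by (simp add: open_K_def openin_Int del: Int_iff)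
next
  fix F :: "K set set"
  assume F: "\<forall>S\<in>F. open S"
  have "{z \<in> std_triangle. K_pt \<tau> z \<in> \<Union>F} = (\<Union>S\<in>F. {z \<in> std_triangle. K_pt \<tau> z \<in> S})" for \<tau>
    by auto
  then show "open (\<Union>F)"
    using F by (auto simp only: open_K_def intro!: openin_Union)
qed

end

text \<open>The quotient length metric: the infimum of the lengths of strings of points in which consecutive
  points lie in a common triangle.\<close>

inductive K_string :: "K \<Rightarrow> K \<Rightarrow> real \<Rightarrow> bool" where
  Nil: "K_string P P 0"
| Cons: "\<tau> \<in> K_triangles \<Longrightarrow> z \<in> std_triangle \<Longrightarrow> w \<in> std_triangle \<Longrightarrow>
         K_string (K_pt \<tau> w) Q r \<Longrightarrow> K_string (K_pt \<tau> z) Q (dist z w + r)"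

definition K_dist :: "K \<Rightarrow> K \<Rightarrow> real" where
  "K_dist P Q = Inf {r. K_string P Q r}"

definition K_vertex :: K where
  "K_vertex = K_pt (La, Le, Lt1) 0"

lemma K_single_vertex:
  assumes "\<tau> \<in> K_triangles" "z \<in> {0, 1, cis (pi / 3)}"
  shows "K_pt \<tau> z = K_vertex"
proof -
  have tri: "(La, Le, Lt1) \<in> K_triangles" "(Le, Lb, Lt1) \<in> K_triangles" "(Lb, La, Lt1) \<in> K_triangles"
    "(Le, Lbhat, Lt2) \<in> K_triangles" "(Lbhat, Lb2, Lt2) \<in> K_triangles" "(Lb2, Le, Lt2) \<in> K_triangles"
    "(Lbhat, La, Lt3) \<in> K_triangles" "(La, Lb3, Lt3) \<in> K_triangles" "(Lb3, Lbhat, Lt3) \<in> K_triangles"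
    by (auto simp: K_triangles_def Y_triangles_def)
  have start_end:
    "K_pt \<tau> (g 0) = K_pt \<tau>' (g' 0)" "K_pt \<tau> (g 1) = K_pt \<tau>' (g' 1)"
    if "\<tau> \<in> K_triangles" "\<tau>' \<in> K_triangles" "(l, g) \<in> sides \<tau>" "(l, g') \<in> sides \<tau>'" for \<tau> \<tau>' l g g'
    using K_pt_side[OF that, of 0] K_pt_side[OF that, of 1] by auto
  define st en where
    "st \<tau> = K_pt \<tau> 0" and "en \<tau> = K_pt \<tau> (cis (pi / 3))" for \<tau>
  let ?m = "\<lambda>\<tau>. K_pt \<tau> 1"
  have uu: "st (u,v,w) = st (u,v',w') \<and> ?m (u,v,w) = ?m (u,v',w')"
    if "(u,v,w) \<in> K_triangles" "(u,v',w') \<in> K_triangles" for u v w v' w'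
    using start_end[OF that, of u "linepath 0 1" "linepath 0 1"] by (simp add: st_def linepath_def)
  have uv: "st (u,v,w) = ?m (u',u,w') \<and> ?m (u,v,w) = en (u',u,w')"
    if "(u,v,w) \<in> K_triangles" "(u',u,w') \<in> K_triangles" for u v w u' w'
    using start_end[OF that, of u "linepath 0 1" "linepath 1 (cis (pi / 3))"]
    by (simp add: st_def en_def linepath_def)
  have ww: "st (u,v,w) = st (u',v',w) \<and> en (u,v,w) = en (u',v',w)"
    if "(u,v,w) \<in> K_triangles" "(u',v',w) \<in> K_triangles" for u v w u' v'
    using start_end[OF that, of w "linepath 0 (cis (pi / 3))" "linepath 0 (cis (pi / 3))"]
    by (simp add: st_def en_def linepath_def)
  note Y1 = ww[OF tri(1) tri(2)] ww[OF tri(1) tri(3)] uv[OF tri(2) tri(1)] uv[OF tri(3) tri(2)] uv[OF tri(1) tri(3)]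
  note Y2 = ww[OF tri(4) tri(5)] ww[OF tri(4) tri(6)] uv[OF tri(5) tri(4)] uv[OF tri(6) tri(5)] uv[OF tri(4) tri(6)]
  note Y3 = ww[OF tri(7) tri(8)] ww[OF tri(7) tri(9)] uv[OF tri(8) tri(7)] uv[OF tri(9) tri(8)] uv[OF tri(7) tri(9)]
  note Y = Y1 Y2 Y3 uu[OF tri(2) tri(4)] uu[OF tri(5) tri(7)] uu[OF tri(8) tri(1)]
  have "K_vertex = st (La, Le, Lt1)" by (simp add: K_vertex_def st_def)
  then have "st \<tau> = K_vertex \<and> ?m \<tau> = K_vertex \<and> en \<tau> = K_vertex"
    using assms(1) Y unfolding K_triangles_def Y_triangles_def
    by (elim UnE insertE emptyE; hypsubst; argo)
  then show ?thesis using assms(2) by (auto simp: st_def en_def)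
qed

text \<open>Well defined on \<open>{0..1}\<close> by \<open>K_pt_side\<close>; see \<open>K_loop_eq\<close>.\<close>

definition K_loop :: "loop_label \<Rightarrow> real \<Rightarrow> K" where
  "K_loop l s = (THE P. \<exists>\<tau>\<in>K_triangles. \<exists>g. (l, g) \<in> sides \<tau> \<and> P = K_pt \<tau> (g s))"

lemma K_loop_eq:
  assumes "\<tau> \<in> K_triangles" "(l, g) \<in> sides \<tau>" "s \<in> {0..1}"
  shows "K_loop l s = K_pt \<tau> (g s)"
  unfolding K_loop_def
proof (rule the_equality)
  show "\<exists>\<tau>'\<in>K_triangles. \<exists>g'. (l, g') \<in> sides \<tau>' \<and> K_pt \<tau> (g s) = K_pt \<tau>' (g' s)"
    using assms(1,2) by blast
  fix P
  assume "\<exists>\<tau>\<in>K_triangles. \<exists>g. (l, g) \<in> sides \<tau> \<and> P = K_pt \<tau> (g s)"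
  then obtain \<tau>' g' where "\<tau>' \<in> K_triangles" "(l, g') \<in> sides \<tau>'" "P = K_pt \<tau>' (g' s)"
    by blast
  then show "P = K_pt \<tau> (g s)"
    using K_pt_side[of \<tau>' \<tau> l g' g s] assms by simp
qed

fun rot_label :: "loop_label \<Rightarrow> loop_label" where
  "rot_label La = Le" | "rot_label Le = Lbhat" | "rot_label Lbhat = La"
| "rot_label Lb = Lb2" | "rot_label Lb2 = Lb3" | "rot_label Lb3 = Lb"
| "rot_label Lt1 = Lt2" | "rot_label Lt2 = Lt3" | "rot_label Lt3 = Lt1"

fun rot_triangle :: "triangle \<Rightarrow> triangle" where
  "rot_triangle (u, v, w) = (rot_label u, rot_label v, rot_label w)"

text \<open>Well defined because relabelling preserves the gluing; see \<open>K_rot_K_pt\<close>.\<close>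

definition K_rot :: "K \<Rightarrow> K" where
  "K_rot P = (THE Q. \<exists>\<tau>\<in>K_triangles. \<exists>z\<in>std_triangle. P = K_pt \<tau> z \<and> Q = K_pt (rot_triangle \<tau>) z)"

lemma rot_triangle_in: "\<tau> \<in> K_triangles \<Longrightarrow> rot_triangle \<tau> \<in> K_triangles"
  by (auto simp: K_triangles_def Y_triangles_def)

lemma K_rot_K_pt:
  assumes "\<tau> \<in> K_triangles" "z \<in> std_triangle"
  shows "K_rot (K_pt \<tau> z) = K_pt (rot_triangle \<tau>) z"
proof -
  have sides_rot: "(rot_label l, g) \<in> sides (rot_triangle \<tau>)" if "(l, g) \<in> sides \<tau>" for l g \<tau>
    using that by (cases \<tau>) auto
  have step: "((rot_triangle (fst p), snd p), (rot_triangle (fst q), snd q)) \<in> glue_sides"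
    if "(p, q) \<in> glue_sides" for p q
  proof -
    from that obtain \<tau> \<tau>' l g g' s where *: "p = (\<tau>, g s)" "q = (\<tau>', g' s)"
        "\<tau> \<in> K_triangles" "\<tau>' \<in> K_triangles" "(l, g) \<in> sides \<tau>" "(l, g') \<in> sides \<tau>'" "s \<in> {0..1}"
      unfolding glue_sides_def by blast
    have "((rot_triangle \<tau>, g s), (rot_triangle \<tau>', g' s)) \<in> glue_sides"
      unfolding glue_sides_def using *(3-) sides_rot rot_triangle_in by blast
    then show ?thesis by (simp add: *)
  qed
  have steps: "((rot_triangle (fst p), snd p), (rot_triangle (fst q), snd q)) \<in> glue_sides\<^sup>*"
    if "(p, q) \<in> glue_sides\<^sup>*" for p q
    using that by (induction rule: rtrancl_induct) (auto intro: rtrancl_into_rtrancl step)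
  have unique: "K_pt (rot_triangle \<tau>) z = K_pt (rot_triangle \<tau>') z'"
    if "\<tau>' \<in> K_triangles" "z' \<in> std_triangle" "K_pt \<tau> z = K_pt \<tau>' z'" for \<tau>' z'
    using that assms steps[of "(\<tau>, z)" "(\<tau>', z')"]
    by (auto simp: K_pt_eq_iff rot_triangle_in glue_def)
  show ?thesis
    unfolding K_rot_def
  proof (rule the_equality)
    show "\<exists>\<tau>'\<in>K_triangles. \<exists>z'\<in>std_triangle.
        K_pt \<tau> z = K_pt \<tau>' z' \<and> K_pt (rot_triangle \<tau>) z = K_pt (rot_triangle \<tau>') z'"
      using assms by blast
  next
    fix Q
    assume "\<exists>\<tau>'\<in>K_triangles. \<exists>z'\<in>std_triangle. K_pt \<tau> z = K_pt \<tau>' z' \<and> Q = K_pt (rot_triangle \<tau>') z'"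
    then obtain \<tau>' z' where "\<tau>' \<in> K_triangles" "z' \<in> std_triangle" "K_pt \<tau> z = K_pt \<tau>' z'"
      "Q = K_pt (rot_triangle \<tau>') z'"
      by blast
    with unique show "Q = K_pt (rot_triangle \<tau>) z" by simp
  qed
qed

section \<open>The universal cover and the action of G1 on it\<close>

definition universal_cover :: "'c::topological_space set \<Rightarrow> ('c \<Rightarrow> 'k::topological_space) \<Rightarrow> bool" where
  "universal_cover X1 pr \<longleftrightarrow> covering_space X1 pr UNIV \<and> simply_connected X1"

definition path_length :: "('a \<Rightarrow> 'a \<Rightarrow> real) \<Rightarrow> (real \<Rightarrow> 'a) \<Rightarrow> ereal" where
  "path_length d c = Sup {ereal (\<Sum>i<n. d (c (t i)) (c (t (Suc i)))) | n t.
     (\<forall>i\<le>n. t i \<in> {0..1}) \<and> (\<forall>i<n. t i \<le> t (Suc i))}"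

text \<open>The length metric induced on \<open>X1\<close>: the length of a path is that of its projection to \<open>K\<close>.\<close>

definition X1_dist :: "'c::topological_space set \<Rightarrow> ('c \<Rightarrow> K) \<Rightarrow> 'c \<Rightarrow> 'c \<Rightarrow> real" where
  "X1_dist X1 pr x y = real_of_ereal (Inf {path_length K_dist (pr \<circ> c) | c.
     path c \<and> path_image c \<subseteq> X1 \<and> pathstart c = x \<and> pathfinish c = y})"

definition X1_vertices :: "'c set \<Rightarrow> ('c \<Rightarrow> K) \<Rightarrow> 'c set" where
  "X1_vertices X1 pr = {x \<in> X1. pr x = K_vertex}"

definition is_lift :: "'c::topological_space set \<Rightarrow> ('c \<Rightarrow> K) \<Rightarrow> (K \<Rightarrow> K) \<Rightarrow> ('c \<Rightarrow> 'c) \<Rightarrow> bool" where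
  "is_lift X1 pr \<sigma> h \<longleftrightarrow> (\<exists>k. homeomorphism X1 X1 h k) \<and> (\<forall>x\<in>X1. pr (h x) = \<sigma> (pr x))"

text \<open>The deck transformation corresponding to a loop takes the base vertex to the end point of the lift
  of the loop that starts there.\<close>

definition deck_of_loop ::
  "'c::topological_space set \<Rightarrow> ('c \<Rightarrow> K) \<Rightarrow> 'c \<Rightarrow> (real \<Rightarrow> K) \<Rightarrow> ('c \<Rightarrow> 'c) \<Rightarrow> bool" where
  "deck_of_loop X1 pr v \<gamma> h \<longleftrightarrow> is_lift X1 pr id h \<and>
     (\<exists>c. path c \<and> path_image c \<subseteq> X1 \<and> pathstart c = v \<and> pathfinish c = h v \<and>
          (\<forall>s\<in>{0..1}. pr (c s) = \<gamma> s))"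

definition G1_action_on_X1 :: "'c::topological_space set \<Rightarrow> ('c \<Rightarrow> K) \<Rightarrow> 'c \<Rightarrow>
    (braid_gen word set set \<Rightarrow> 'c \<Rightarrow> 'c) \<Rightarrow> bool" where
  "G1_action_on_X1 X1 pr v \<rho> \<longleftrightarrow>
     group_action G1 X1 \<rho> \<and>
     deck_of_loop X1 pr v (K_loop La) (\<rho> G0_a) \<and>
     deck_of_loop X1 pr v (K_loop Le) (\<rho> G0_e) \<and>
     deck_of_loop X1 pr v (K_loop Lbhat) (\<rho> G0_bhat) \<and>
     is_lift X1 pr K_rot (\<rho> G0_y) \<and> \<rho> G0_y v = v"

section \<open>CAT(0) spaces, covering dimension, group actions\<close>

text \<open>A linearly reparametrised geodesic from \<open>x\<close> to \<open>y\<close>.\<close>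

definition is_geodesic :: "'a set \<Rightarrow> ('a \<Rightarrow> 'a \<Rightarrow> real) \<Rightarrow> (real \<Rightarrow> 'a) \<Rightarrow> 'a \<Rightarrow> 'a \<Rightarrow> bool" where
  "is_geodesic X d c x y \<longleftrightarrow> c ` {0..1} \<subseteq> X \<and> c 0 = x \<and> c 1 = y \<and>
     (\<forall>s\<in>{0..1}. \<forall>t\<in>{0..1}. d (c s) (c t) = abs (s - t) * d x y)"

text \<open>The pairs of a point on a geodesic triangle with sides \<open>c1\<close>, \<open>c2\<close>, \<open>c3\<close> and its comparison point on
  the Euclidean triangle with corners \<open>p\<close>, \<open>q\<close>, \<open>r\<close>.\<close>

definition comparison_pairs ::
  "(real \<Rightarrow> 'a) \<Rightarrow> (real \<Rightarrow> 'a) \<Rightarrow> (real \<Rightarrow> 'a) \<Rightarrow> complex \<Rightarrow> complex \<Rightarrow> complex \<Rightarrow> ('a \<times> complex) set" where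
  "comparison_pairs c1 c2 c3 p q r =
     (\<lambda>s. (c1 s, linepath p q s)) ` {0..1} \<union>
     (\<lambda>s. (c2 s, linepath q r s)) ` {0..1} \<union>
     (\<lambda>s. (c3 s, linepath r p s)) ` {0..1}"

definition CAT0 :: "'a set \<Rightarrow> ('a \<Rightarrow> 'a \<Rightarrow> real) \<Rightarrow> bool" where
  "CAT0 X d \<longleftrightarrow> Metric_space X d \<and>
     (\<forall>x\<in>X. \<forall>y\<in>X. \<exists>c. is_geodesic X d c x y) \<and>
     (\<forall>x y z c1 c2 c3 p q r.
        is_geodesic X d c1 x y \<and> is_geodesic X d c2 y z \<and> is_geodesic X d c3 z x \<and>
        dist p q = d x y \<and> dist q r = d y z \<and> dist r p = d z x \<longrightarrow>
        (\<forall>(u, u')\<in>comparison_pairs c1 c2 c3 p q r. \<forall>(v, v')\<in>comparison_pairs c1 c2 c3 p q r.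
           d u v \<le> dist u' v'))"

text \<open>Arbitrary open covers are refined; for metrisable spaces finite covers give the same dimension.\<close>

definition covering_dim_le :: "'a topology \<Rightarrow> nat \<Rightarrow> bool" where
  "covering_dim_le T n \<longleftrightarrow>
     (\<forall>\<U>. (\<forall>U\<in>\<U>. openin T U) \<and> \<Union>\<U> = topspace T \<longrightarrow>
       (\<exists>\<V>. (\<forall>V\<in>\<V>. openin T V \<and> (\<exists>U\<in>\<U>. V \<subseteq> U)) \<and> \<Union>\<V> = topspace T \<and>
            (\<forall>x\<in>topspace T. finite {V\<in>\<V>. x \<in> V} \<and> card {V\<in>\<V>. x \<in> V} \<le> n + 1)))"

definition has_covering_dim :: "'a topology \<Rightarrow> nat \<Rightarrow> bool" where
  "has_covering_dim T n \<longleftrightarrow> covering_dim_le T n \<and> (\<forall>m<n. \<not> covering_dim_le T m)"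

definition isometric_action ::
  "('g, 'm) monoid_scheme \<Rightarrow> 'a set \<Rightarrow> ('a \<Rightarrow> 'a \<Rightarrow> real) \<Rightarrow> ('g \<Rightarrow> 'a \<Rightarrow> 'a) \<Rightarrow> bool" where
  "isometric_action G X d \<phi> \<longleftrightarrow> group_action G X \<phi> \<and>
     (\<forall>g\<in>carrier G. \<forall>x\<in>X. \<forall>y\<in>X. d (\<phi> g x) (\<phi> g y) = d x y)"

text \<open>For isometric actions this is equivalent to the condition that, for every compact set \<open>C\<close>, only
  finitely many group elements \<open>g\<close> satisfy \<open>g C \<inter> C \<noteq> {}\<close>.\<close>

definition proper_action ::
  "('g, 'm) monoid_scheme \<Rightarrow> 'a set \<Rightarrow> ('a \<Rightarrow> 'a \<Rightarrow> real) \<Rightarrow> ('g \<Rightarrow> 'a \<Rightarrow> 'a) \<Rightarrow> bool" where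
  "proper_action G X d \<phi> \<longleftrightarrow>
     (\<forall>x\<in>X. \<exists>r>0. finite {g \<in> carrier G.
        \<phi> g ` Metric_space.mball X d x r \<inter> Metric_space.mball X d x r \<noteq> {}})"

definition cocompact_action ::
  "('g, 'm) monoid_scheme \<Rightarrow> 'a set \<Rightarrow> ('a \<Rightarrow> 'a \<Rightarrow> real) \<Rightarrow> ('g \<Rightarrow> 'a \<Rightarrow> 'a) \<Rightarrow> bool" where
  "cocompact_action G X d \<phi> \<longleftrightarrow>
     (\<exists>C. compactin (Metric_space.mtopology X d) C \<and> (\<Union>g\<in>carrier G. \<phi> g ` C) = X)"

definition geometric_action ::
  "('g, 'm) monoid_scheme \<Rightarrow> 'a set \<Rightarrow> ('a \<Rightarrow> 'a \<Rightarrow> real) \<Rightarrow> ('g \<Rightarrow> 'a \<Rightarrow> 'a) \<Rightarrow> bool" where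
  "geometric_action G X d \<phi> \<longleftrightarrow>
     isometric_action G X d \<phi> \<and> proper_action G X d \<phi> \<and> cocompact_action G X d \<phi>"

definition semisimple_isometry :: "'a set \<Rightarrow> ('a \<Rightarrow> 'a \<Rightarrow> real) \<Rightarrow> ('a \<Rightarrow> 'a) \<Rightarrow> bool" where
  "semisimple_isometry X d h \<longleftrightarrow> (\<exists>p\<in>X. \<forall>q\<in>X. d p (h p) \<le> d q (h q))"

section \<open>Conditions on the map\<close>

definition equivariant_map :: "('g, 'm) monoid_scheme \<Rightarrow> 'a set \<Rightarrow> ('g \<Rightarrow> 'a \<Rightarrow> 'a) \<Rightarrow>
    ('g \<Rightarrow> 'b \<Rightarrow> 'b) \<Rightarrow> ('a \<Rightarrow> 'b) \<Rightarrow> bool" where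
  "equivariant_map G S \<rho> \<phi> f \<longleftrightarrow> (\<forall>g\<in>carrier G. \<forall>x\<in>S. f (\<rho> g x) = \<phi> g (f x))"

definition locally_injective :: "'a::topological_space set \<Rightarrow> ('a \<Rightarrow> 'b) \<Rightarrow> bool" where
  "locally_injective S f \<longleftrightarrow> (\<forall>x\<in>S. \<exists>N. openin (top_of_set S) N \<and> x \<in> N \<and> inj_on f N)"

definition locally_isometric_up_to_scaling ::
  "'a::topological_space set \<Rightarrow> ('a \<Rightarrow> 'a \<Rightarrow> real) \<Rightarrow> ('b \<Rightarrow> 'b \<Rightarrow> real) \<Rightarrow> ('a \<Rightarrow> 'b) \<Rightarrow> bool" where
  "locally_isometric_up_to_scaling U d d' f \<longleftrightarrow>
     (\<exists>r>0. \<forall>x\<in>U. \<exists>N. openin (top_of_set U) N \<and> x \<in> N \<and>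
        (\<forall>p\<in>N. \<forall>q\<in>N. d' (f p) (f q) = r * d p q))"

end

theory Submission
  imports Defs
begin

text \<open>Put \<open>p = f1 v\<close>, a point fixed by \<open>y\<close>, and let \<open>r\<close> be the scaling factor. Since \<open>c\<^sup>2 = (a e)\<^sup>-\<^sup>1 y\<close> and \<open>v\<close> is joined
  to \<open>a e v\<close> by an edge labelled \<open>t\<^sub>1\<close>, the element \<open>c\<^sup>2\<close> moves \<open>p\<close> by at most \<open>r\<close>. On the other hand \<open>a\<close> translates the
  midline of a strip of triangles of \<open>X1\<close> (alternately \<open>a e = t\<^sub>1\<close> and \<open>e b = t\<^sub>1\<close>) by 1. This line avoids the vertices,
  so \<open>f1\<close> maps it to a local geodesic, which is a geodesic because \<open>X\<close> is CAT(0). Hence \<open>a\<close> has translation length \<open>r\<close>, and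
  so has \<open>c\<close>, a conjugate of \<open>a\<close> in \<open>G0\<close>. But then \<open>c\<^sup>2\<close> has translation length \<open>2 r > r\<close>.\<close>

section \<open>Relations in G0\<close>

text \<open>The formula for \<open>c\<^sup>2\<close> comes from \<open>y = b a c c\<close> and
  \<open>a e = b a\<close>. Translation lengths are compared through powers: the n-th power of
  \<open>c\<^sup>2\<close> moves \<open>p\<close> by at most \<open>n r\<close>, but a point of an
  axis of \<open>c\<close> by exactly \<open>2 n r\<close>, and the two displacements differ by at
  most twice the distance of the two points, which does not depend on \<open>n\<close>. Two
  obstacles shape the geometry. The metric of \<open>X1\<close> is an infimum of path lengths,
  measured in \<open>K\<close> by an infimum over strings, so a lower bound for a distance needs a
  1-Lipschitz function on \<open>K\<close>. Near the midpoint of an edge such a function is obtained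
  by unfolding the triangles at that edge into the plane. Secondly, the scaling property says
  nothing at vertices. The axis therefore crosses edges at their midpoints, and the bound along the
  edge from \<open>v\<close> to \<open>a e v\<close> is proved on the open edge and carried to its
  ends by continuity. Since \<open>X1\<close> is an abstract covering space, the triangles of the
  strip first have to be constructed as lifts, and their adjacency is read off from uniqueness of
  lifts.\<close>

lemma G0_word_mult: "G0_word u \<otimes>\<^bsub>G0\<^esub> G0_word v = G0_word (u @ v)"
proof -
  have cls: "(THE U. U \<in> carrier B4 \<and> w \<in> U) \<in> carrier B4 \<and> w \<in> (THE U. U \<in> carrier B4 \<and> w \<in> U)" for w
    unfolding B4_def by (rule theI'[OF ex1_class])
  have "(THE U. U \<in> carrier B4 \<and> w \<in> U) = {x. word_eq {([(Gen_a, True), (Gen_b, True), (Gen_a, True)], [(Gen_b, True), (Gen_a, True), (Gen_b, True)]),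
      ([(Gen_b, True), (Gen_c, True), (Gen_b, True)], [(Gen_c, True), (Gen_b, True), (Gen_c, True)]),
      ([(Gen_a, True), (Gen_c, True)], [(Gen_c, True), (Gen_a, True)])} w x}" for w
    unfolding B4_def
    by (rule the1_equality[OF ex1_class]) (simp add: carrier_presented_group word_eq.refl)
  then have "(THE U. U \<in> carrier B4 \<and> u \<in> U) \<otimes>\<^bsub>B4\<^esub> (THE U. U \<in> carrier B4 \<and> v \<in> U)
      = (THE U. U \<in> carrier B4 \<and> u @ v \<in> U)"
    by (simp only:) (simp add: B4_def mult_presented_group)
  then show ?thesis
    using normal.rcos_sum[OF group.group_center_normal[OF group_B4]] cls
    by (simp add: G0_word_def G0_def FactGroup_def)
qed

lemma G0_word_relation:
  assumes "(u, v) \<in> {([(Gen_a, True), (Gen_b, True), (Gen_a, True)], [(Gen_b, True), (Gen_a, True), (Gen_b, True)]),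
      ([(Gen_b, True), (Gen_c, True), (Gen_b, True)], [(Gen_c, True), (Gen_b, True), (Gen_c, True)]),
      ([(Gen_a, True), (Gen_c, True)], [(Gen_c, True), (Gen_a, True)])}" (is "_ \<in> ?R")
  shows "G0_word u = G0_word v"
proof -
  have "{w. word_eq ?R u w} = {w. word_eq ?R v w}"
    unfolding word_eq_class_eq by (rule word_eq.relation) (rule assms)
  moreover have "(THE U. U \<in> carrier B4 \<and> w \<in> U) = {x. word_eq ?R w x}" for w
    unfolding B4_def
    by (rule the1_equality[OF ex1_class]) (simp add: carrier_presented_group word_eq.refl)
  ultimately show ?thesis by (simp add: G0_word_def)
qed

lemma G0_generators_closed [simp]:
  "G0_a \<in> carrier G0" "G0_b \<in> carrier G0" "G0_c \<in> carrier G0"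
  by (simp_all add: G0_a_def G0_b_def G0_c_def G0_word_closed)

lemma G0_braid_relations:
  "G0_a \<otimes>\<^bsub>G0\<^esub> G0_b \<otimes>\<^bsub>G0\<^esub> G0_a = G0_b \<otimes>\<^bsub>G0\<^esub> G0_a \<otimes>\<^bsub>G0\<^esub> G0_b"
  "G0_b \<otimes>\<^bsub>G0\<^esub> G0_c \<otimes>\<^bsub>G0\<^esub> G0_b = G0_c \<otimes>\<^bsub>G0\<^esub> G0_b \<otimes>\<^bsub>G0\<^esub> G0_c"
  "G0_a \<otimes>\<^bsub>G0\<^esub> G0_c = G0_c \<otimes>\<^bsub>G0\<^esub> G0_a"
  by (simp_all add: G0_a_def G0_b_def G0_c_def G0_word_mult G0_word_relation)

lemma (in group) braid_conjugate:
  assumes "a \<in> carrier G" "b \<in> carrier G" "a \<otimes> b \<otimes> a = b \<otimes> a \<otimes> b"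
  shows "(a \<otimes> b) \<otimes> a \<otimes> inv (a \<otimes> b) = b"
proof -
  have "b = (a \<otimes> b \<otimes> a) \<otimes> inv (a \<otimes> b)"
    by (subst inv_solve_right) (use assms m_assoc in auto)
  then show ?thesis by (rule HOL.sym)
qed

text \<open>Each braid relation conjugates a generator to its neighbour: \<open>a b\<close> takes
  \<open>a\<close> to \<open>b\<close>, and \<open>b c\<close> takes \<open>b\<close> to
  \<open>c\<close>, so \<open>(b c)(a b)\<close> takes \<open>a\<close> to \<open>c\<close>.\<close>

lemma G0_c_conjugate_a:
  obtains g where "g \<in> carrier G0" "G0_c = g \<otimes>\<^bsub>G0\<^esub> G0_a \<otimes>\<^bsub>G0\<^esub> inv\<^bsub>G0\<^esub> g"
proof -
  interpret group G0 by (rule group_G0)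
  let ?u = "G0_a \<otimes>\<^bsub>G0\<^esub> G0_b" and ?v = "G0_b \<otimes>\<^bsub>G0\<^esub> G0_c"
  have u: "?u \<otimes>\<^bsub>G0\<^esub> G0_a \<otimes>\<^bsub>G0\<^esub> inv\<^bsub>G0\<^esub> ?u = G0_b"
    by (rule braid_conjugate) (simp_all only: G0_generators_closed G0_braid_relations(1))
  have v: "?v \<otimes>\<^bsub>G0\<^esub> G0_b \<otimes>\<^bsub>G0\<^esub> inv\<^bsub>G0\<^esub> ?v = G0_c"
    by (rule braid_conjugate) (simp_all only: G0_generators_closed G0_braid_relations(2))
  have "G0_c = ?v \<otimes>\<^bsub>G0\<^esub> (?u \<otimes>\<^bsub>G0\<^esub> G0_a \<otimes>\<^bsub>G0\<^esub> inv\<^bsub>G0\<^esub> ?u) \<otimes>\<^bsub>G0\<^esub> inv\<^bsub>G0\<^esub> ?v"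
    by (simp only: u v)
  also have "\<dots> = (?v \<otimes>\<^bsub>G0\<^esub> ?u) \<otimes>\<^bsub>G0\<^esub> G0_a \<otimes>\<^bsub>G0\<^esub> inv\<^bsub>G0\<^esub> (?v \<otimes>\<^bsub>G0\<^esub> ?u)"
    by (simp add: m_assoc inv_mult_group)
  finally have "G0_c = (?v \<otimes>\<^bsub>G0\<^esub> ?u) \<otimes>\<^bsub>G0\<^esub> G0_a \<otimes>\<^bsub>G0\<^esub> inv\<^bsub>G0\<^esub> (?v \<otimes>\<^bsub>G0\<^esub> ?u)" .
  then show thesis by (intro that[of "?v \<otimes>\<^bsub>G0\<^esub> ?u"]) simp_all
qed

lemma G0_e_closed: "G0_e \<in> carrier G0" and G0_y_closed: "G0_y \<in> carrier G0"
proof -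
  interpret group G0 by (rule group_G0)
  show "G0_e \<in> carrier G0" "G0_y \<in> carrier G0"
    by (simp_all add: G0_e_def G0_x_def G0_y_def)
qed

text \<open>This places \<open>e\<close> in \<open>G1\<close>, which is generated by
  \<open>a\<close> and \<open>y\<close>, whereas the definition of \<open>e\<close> goes through
  \<open>b\<close>. After multiplication by \<open>a\<close> on the left, \<open>e y = y a\<close>
  reads \<open>b a b a c c = a b a c c a\<close>, which follows from the first braid relation and
  the commuting of \<open>a\<close> and \<open>c\<close>.\<close>

lemma G0_y_conjugates_a_to_e: "G0_e = G0_y \<otimes>\<^bsub>G0\<^esub> G0_a \<otimes>\<^bsub>G0\<^esub> inv\<^bsub>G0\<^esub> G0_y"
proof -
  interpret group G0 by (rule group_G0)
  have ae: "G0_a \<otimes>\<^bsub>G0\<^esub> G0_e = G0_b \<otimes>\<^bsub>G0\<^esub> G0_a"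
    by (simp add: G0_e_def m_assoc[symmetric])
  have ca: "G0_c \<otimes>\<^bsub>G0\<^esub> (G0_c \<otimes>\<^bsub>G0\<^esub> G0_a) = G0_a \<otimes>\<^bsub>G0\<^esub> (G0_c \<otimes>\<^bsub>G0\<^esub> G0_c)"
    by (metis G0_braid_relations(3) G0_generators_closed(1,3) m_assoc)
  have "G0_a \<otimes>\<^bsub>G0\<^esub> (G0_e \<otimes>\<^bsub>G0\<^esub> G0_y) = (G0_b \<otimes>\<^bsub>G0\<^esub> G0_a \<otimes>\<^bsub>G0\<^esub> G0_b) \<otimes>\<^bsub>G0\<^esub> (G0_a \<otimes>\<^bsub>G0\<^esub> (G0_c \<otimes>\<^bsub>G0\<^esub> G0_c))"
    using ae by (simp add: G0_y_def G0_x_def m_assoc[symmetric] G0_e_closed)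
  also have "\<dots> = G0_a \<otimes>\<^bsub>G0\<^esub> (G0_y \<otimes>\<^bsub>G0\<^esub> G0_a)"
    unfolding G0_braid_relations(1)[symmetric] ca[symmetric]
    by (simp add: G0_y_def G0_x_def m_assoc)
  finally have "G0_e \<otimes>\<^bsub>G0\<^esub> G0_y = G0_y \<otimes>\<^bsub>G0\<^esub> G0_a"
    by (simp add: G0_e_closed G0_y_closed)
  then show ?thesis
    by (subst inv_solve_right) (simp_all add: G0_e_closed G0_y_closed)
qed

lemma G0_c_square: "G0_c \<otimes>\<^bsub>G0\<^esub> G0_c = inv\<^bsub>G0\<^esub> (G0_a \<otimes>\<^bsub>G0\<^esub> G0_e) \<otimes>\<^bsub>G0\<^esub> G0_y"
proof -
  interpret group G0 by (rule group_G0)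
  have "G0_a \<otimes>\<^bsub>G0\<^esub> G0_e = G0_b \<otimes>\<^bsub>G0\<^esub> G0_a"
    by (simp add: G0_e_def m_assoc[symmetric])
  then show ?thesis
    by (simp add: G0_y_def G0_x_def m_assoc inv_mult_group) (simp add: m_assoc[symmetric])
qed

lemma G1_memb: "G0_a \<in> carrier G1" "G0_y \<in> carrier G1" "G0_e \<in> carrier G1"
proof -
  interpret group G0 by (rule group_G0)
  interpret G1: group G1 unfolding G1_def by (rule group_subgroup_generated)
  show a: "G0_a \<in> carrier G1" and y: "G0_y \<in> carrier G1"
    by (simp_all add: G1_def carrier_subgroup_generated generate.incl G0_y_closed)
  have "inv\<^bsub>G1\<^esub> G0_y = inv\<^bsub>G0\<^esub> G0_y"
    using y by (simp add: G1_def)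
  then show "G0_e \<in> carrier G1"
    using G1.m_closed[OF G1.m_closed[OF y a] G1.inv_closed[OF y]]
    by (simp add: G0_y_conjugates_a_to_e G1_def)
qed

section \<open>Lifting to covering spaces\<close>

text \<open>Whether the two lifts agree is locally constant: near a point each of them stays in one
  sheet over an evenly covered set, two sheets are equal or disjoint, and the covering map is
  injective on a sheet.\<close>

lemma covering_lift_unique:
  assumes cov: "covering_space C p S" and "connected T"
    and g: "continuous_on T g" "g ` T \<subseteq> C" and h: "continuous_on T h" "h ` T \<subseteq> C"
    and eq: "\<And>x. x \<in> T \<Longrightarrow> p (g x) = p (h x)"
    and a: "a \<in> T" "g a = h a" and "x \<in> T"
  shows "g x = h x"
proof -
  have "(g a = h a) = (g x = h x)"
  proof (rule connected_equivalence_relation[OF \<open>connected T\<close> a(1) \<open>x \<in> T\<close>, where R = "\<lambda>x y. (g x = h x) = (g y = h y)"])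
    fix y assume y: "y \<in> T"
    have "p (g y) \<in> S"
      using covering_space_imp_surjective[OF cov] g(2) y by blast
    then obtain W \<V> where W: "p (g y) \<in> W" "\<Union>\<V> = C \<inter> p -` W"
      and \<V>: "\<And>V. V \<in> \<V> \<Longrightarrow> openin (top_of_set C) V" "pairwise disjnt \<V>" "\<And>V. V \<in> \<V> \<Longrightarrow> \<exists>q. homeomorphism V W p q"
      using cov unfolding covering_space_def by metis
    have "g y \<in> \<Union>\<V>" "h y \<in> \<Union>\<V>"
      using W g(2) h(2) y eq[OF y] by auto
    then obtain U V where U: "U \<in> \<V>" "g y \<in> U" and V: "V \<in> \<V>" "h y \<in> V" by blast
    let ?N = "(T \<inter> g -` U) \<inter> (T \<inter> h -` V)"
    have N: "openin (top_of_set T) ?N"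
      by (intro openin_Int continuous_openin_preimage[OF g(1) _ \<V>(1)[OF U(1)]]
          continuous_openin_preimage[OF h(1) _ \<V>(1)[OF V(1)]]) (use g(2) h(2) in auto)
    have inj: "inj_on p U"
      using \<V>(3)[OF U(1)] by (metis homeomorphism_def inj_on_inverseI)
    have "(g y = h y) = (g z = h z)" if z: "z \<in> ?N" for z
    proof (cases "U = V")
      case True
      have "g y = h y" by (rule inj_onD[OF inj]) (use True U V eq y in auto)
      moreover have "g z = h z" by (rule inj_onD[OF inj]) (use True z eq in auto)
      ultimately show ?thesis by simp
    next
      case False
      then have "disjnt U V" using \<V>(2) U(1) V(1) by (meson pairwiseD)
      then show ?thesis using U V z by (auto simp: disjnt_iff)
    qed
    then show "\<exists>N. openin (top_of_set T) N \<and> y \<in> N \<and> (\<forall>z\<in>N. (g y = h y) = (g z = h z))"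
      using N y U V by (intro exI[of _ ?N]) blast
  qed auto
  then show ?thesis using a(2) by simp
qed

text \<open>A lift is demanded through every point above every point of \<open>R\<close>, so that a
  lift over one piece can be continued over the next from wherever the two pieces meet.\<close>

definition lifts_on :: "'c::topological_space set \<Rightarrow> ('c \<Rightarrow> 'k::topological_space) \<Rightarrow> ('z::topological_space \<Rightarrow> 'k) \<Rightarrow> 'z set \<Rightarrow> bool" where
  "lifts_on C p f R \<longleftrightarrow> (\<forall>z\<in>R. \<forall>x\<in>C. p x = f z \<longrightarrow>
     (\<exists>g. continuous_on R g \<and> g ` R \<subseteq> C \<and> (\<forall>w\<in>R. p (g w) = f w) \<and> g z = x))"

lemma lifts_on_small:
  assumes cov: "covering_space C p UNIV" and f: "continuous_on UNIV f"
  obtains N where "open N" "y \<in> N" "\<And>R. R \<subseteq> N \<Longrightarrow> lifts_on C p f R"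
proof -
  obtain W \<V> where W: "f y \<in> W" "open W" "\<Union>\<V> = C \<inter> p -` W"
    and \<V>: "\<And>V. V \<in> \<V> \<Longrightarrow> \<exists>q. homeomorphism V W p q"
    using cov unfolding covering_space_def openin_subtopology by (metis Int_UNIV_right UNIV_I open_openin)
  show thesis
  proof (rule that[of "f -` W"])
    show "open (f -` W)" using W(2) f by (simp add: open_vimage)
    show "y \<in> f -` W" using W(1) by simp
    fix R assume R: "R \<subseteq> f -` W"
    show "lifts_on C p f R"
      unfolding lifts_on_def
    proof (intro ballI impI)
      fix z x assume z: "z \<in> R" and x: "x \<in> C" "p x = f z"
      then have "x \<in> \<Union>\<V>" using W(3) R by auto
      then obtain V where V: "V \<in> \<V>" "x \<in> V" by blast
      with \<V> obtain q where q: "homeomorphism V W p q" by blast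
      have "continuous_on R (q \<circ> f)"
        using q R f by (intro continuous_on_compose) (auto simp: homeomorphism_def intro: continuous_on_subset)
      moreover have "(q \<circ> f) ` R \<subseteq> C"
        using homeomorphism_image2[OF q] R V W(3) by fastforce
      moreover have "\<forall>w\<in>R. p ((q \<circ> f) w) = f w"
        using q R unfolding homeomorphism_def by auto
      moreover have "(q \<circ> f) z = x"
        using q V x unfolding homeomorphism_def by (metis comp_apply)
      ultimately show "\<exists>g. continuous_on R g \<and> g ` R \<subseteq> C \<and> (\<forall>w\<in>R. p (g w) = f w) \<and> g z = x" by blast
    qed
  qed
qed

text \<open>A lift over one set is continued over the other from a common point. Connectedness of
  the overlap makes the two lifts agree on all of it, and closedness makes the pasted map
  continuous.\<close>

lemma lifts_on_Un:
  assumes cov: "covering_space C p UNIV" and A: "closed A" "lifts_on C p f A" and B: "closed B" "lifts_on C p f B"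
    and AB: "connected (A \<inter> B)" "A \<inter> B \<noteq> {}"
  shows "lifts_on C p f (A \<union> B)"
proof -
  have *: "\<exists>g. continuous_on (A \<union> B) g \<and> g ` (A \<union> B) \<subseteq> C \<and> (\<forall>w\<in>A \<union> B. p (g w) = f w) \<and> g z = x"
    if z: "z \<in> A" and x: "x \<in> C" "p x = f z" and A: "closed A" "lifts_on C p f A" and B: "closed B" "lifts_on C p f B"
    and AB: "connected (A \<inter> B)" "A \<inter> B \<noteq> {}" for z x A B
  proof -
    obtain g where g: "continuous_on A g" "g ` A \<subseteq> C" "\<And>w. w \<in> A \<Longrightarrow> p (g w) = f w" "g z = x"
      using A(2) z x unfolding lifts_on_def by metis
    obtain w where w: "w \<in> A" "w \<in> B" using AB(2) by blast
    then have "g w \<in> C" "p (g w) = f w" using g by auto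
    then obtain h where h: "continuous_on B h" "h ` B \<subseteq> C" "\<And>w. w \<in> B \<Longrightarrow> p (h w) = f w" "h w = g w"
      using B(2) w(2) unfolding lifts_on_def by metis
    have eq: "g u = h u" if u: "u \<in> A \<inter> B" for u
    proof (rule covering_lift_unique[OF cov AB(1), of _ _ w])
      show "continuous_on (A \<inter> B) g" "continuous_on (A \<inter> B) h"
        using g(1) h(1) by (auto intro: continuous_on_subset)
    qed (use g h w u in auto)
    let ?k = "\<lambda>u. if u \<in> A then g u else h u"
    have "continuous_on (A \<union> B) ?k"
      by (rule continuous_on_cases) (use A(1) B(1) g(1) h(1) eq in auto)
    moreover have "?k ` (A \<union> B) \<subseteq> C" "\<forall>w\<in>A \<union> B. p (?k w) = f w" "?k z = x"
      using g h z by auto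
    ultimately show ?thesis by blast
  qed
  show ?thesis
    unfolding lifts_on_def
  proof (intro ballI impI)
    fix z x assume "z \<in> A \<union> B" "x \<in> C" "p x = f z"
    then show "\<exists>g. continuous_on (A \<union> B) g \<and> g ` (A \<union> B) \<subseteq> C \<and> (\<forall>w\<in>A \<union> B. p (g w) = f w) \<and> g z = x"
    proof (elim UnE)
      assume "z \<in> A"
      then show ?thesis by (rule *) (use A B AB \<open>x \<in> C\<close> \<open>p x = f z\<close> in auto)
    next
      assume "z \<in> B"
      then show ?thesis
        by (subst (1 2 3) Un_commute, rule *) (use A B AB \<open>x \<in> C\<close> \<open>p x = f z\<close> in \<open>auto simp: Int_commute\<close>)
    qed
  qed
qed

text \<open>Subdivision in two stages, each by the interval induction \<open>Bolzano\<close>: the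
  inner one produces lifts over sufficiently flat strips of full width about the height
  \<open>y\<close>, the outer one stacks the strips. Consecutive rectangles meet in a segment, which
  is connected. The small rectangles may stick out of the given one, so \<open>f\<close> is
  continuous on the whole plane.\<close>

lemma lifts_on_rectangle:
  fixes f :: "real \<times> real \<Rightarrow> 'k::topological_space"
  assumes cov: "covering_space C p UNIV" and f: "continuous_on UNIV f" and ab: "a \<le> b" and cd: "c \<le> d"
  shows "lifts_on C p f ({a..b} \<times> {c..d})"
  using cd
proof (induction rule: Bolzano)
  case (trans c d e)
  have "{a..b} \<times> {c..e} = ({a..b} \<times> {c..d}) \<union> ({a..b} \<times> {d..e})"
    using trans by auto
  moreover have "({a..b} \<times> {c..d}) \<inter> ({a..b} \<times> {d..e}) = {a..b} \<times> {d}"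
    using trans by auto
  moreover have "connected ({a..b} \<times> {d})" by (intro connected_Times) auto
  ultimately show ?case
    using lifts_on_Un[OF cov _ trans(1) _ trans(2)] ab by (simp add: closed_Times)
next
  case (local y)
  have "\<exists>r>0. \<forall>c d. c \<le> y \<and> y \<le> d \<and> d - c < r \<longrightarrow> lifts_on C p f ({a..b} \<times> {c..d})"
    using ab
  proof (induction rule: Bolzano)
    case (trans a b e)
    then obtain r s where r: "r > 0" "\<And>c d. c \<le> y \<Longrightarrow> y \<le> d \<Longrightarrow> d - c < r \<Longrightarrow> lifts_on C p f ({a..b} \<times> {c..d})"
      and s: "s > 0" "\<And>c d. c \<le> y \<Longrightarrow> y \<le> d \<Longrightarrow> d - c < s \<Longrightarrow> lifts_on C p f ({b..e} \<times> {c..d})"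
      by metis
    show ?case
    proof (intro exI[of _ "min r s"] conjI allI impI)
      show "min r s > 0" using r s by simp
      fix c d assume cd: "c \<le> y \<and> y \<le> d \<and> d - c < min r s"
      have "{a..e} \<times> {c..d} = ({a..b} \<times> {c..d}) \<union> ({b..e} \<times> {c..d})"
        using trans by auto
      moreover have "({a..b} \<times> {c..d}) \<inter> ({b..e} \<times> {c..d}) = {b} \<times> {c..d}"
        using trans by auto
      moreover have "connected ({b} \<times> {c..d})" by (intro connected_Times) auto
      ultimately show "lifts_on C p f ({a..e} \<times> {c..d})"
        using lifts_on_Un[OF cov _ r(2) _ s(2)] cd by (simp add: closed_Times)
    qed
  next
    case (local x)
    obtain N where N: "open N" "(x, y) \<in> N" "\<And>R. R \<subseteq> N \<Longrightarrow> lifts_on C p f R"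
      using lifts_on_small[OF cov f] by metis
    obtain A B where AB: "open A" "open B" "(x, y) \<in> A \<times> B" "A \<times> B \<subseteq> N"
      using open_prod_elim[OF N(1,2)] by metis
    obtain r s where r: "r > 0" "ball x r \<subseteq> A" and s: "s > 0" "ball y s \<subseteq> B"
      using AB by (metis mem_Sigma_iff openE)
    have "lifts_on C p f ({a..b} \<times> {c..d})"
      if "a \<le> x" "x \<le> b" "b - a < r" "c \<le> y" "y \<le> d" "d - c < s" for a b c d
    proof (rule N(3))
      have "{a..b} \<subseteq> ball x r" "{c..d} \<subseteq> ball y s" using that by (auto simp: dist_real_def)
      then show "{a..b} \<times> {c..d} \<subseteq> N" using r s AB by blast
    qed
    then show ?case using r(1) s(1) by (intro exI[of _ r]) blast
  qed
  then show ?case by blast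
qed

section \<open>Local geodesics in CAT(0) spaces\<close>

text \<open>Stated for an arbitrary set of parameters, so that open windows around a point and
  closed intervals are treated alike.\<close>

definition const_speed_on :: "('x \<Rightarrow> 'x \<Rightarrow> real) \<Rightarrow> real \<Rightarrow> (real \<Rightarrow> 'x) \<Rightarrow> real set \<Rightarrow> bool" where
  "const_speed_on d r \<beta> I \<longleftrightarrow> (\<forall>s\<in>I. \<forall>t\<in>I. d (\<beta> s) (\<beta> t) = r * \<bar>s - t\<bar>)"

lemma const_speed_on_imp_geodesic:
  assumes "const_speed_on d r \<beta> {a..b}" "\<beta> ` {a..b} \<subseteq> X" "a \<le> b"
  shows "is_geodesic X d (\<lambda>s. \<beta> (a + s * (b - a))) (\<beta> a) (\<beta> b)"
proof -
  have mem: "a + s * (b - a) \<in> {a..b}" if "s \<in> {0..1}" for s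
    using that assms(3) mult_left_le_one_le[of "b - a" s] by auto
  moreover have "\<bar>s * (b - a) - t * (b - a)\<bar> = \<bar>s - t\<bar> * \<bar>b - a\<bar>" for s t
    by (simp add: left_diff_distrib[symmetric] abs_mult)
  ultimately show ?thesis
    using assms by (auto simp: is_geodesic_def const_speed_on_def abs_minus_commute[of a b])
qed

text \<open>Law of cosines: the corners are \<open>A\<close>, 0 and \<open>w\<close>, and
  \<open>k\<close> is the cosine of the angle at 0. The triangle inequalities put \<open>k\<close>
  between -1 and 1.\<close>

lemma euclidean_triangle_exists:
  fixes A B C :: real
  assumes "A > 0" "B > 0" "A \<le> B + C" "B \<le> C + A" "C \<le> A + B"
  obtains p q w :: complex where "dist p q = A" "dist q w = B" "dist w p = C"
proof -
  define k where "k = (A\<^sup>2 + B\<^sup>2 - C\<^sup>2) / (2 * A * B)"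
  define w where "w = of_real B * cis (arccos k)"
  have C: "C \<ge> 0" using assms by linarith
  have "(A - B)\<^sup>2 \<le> C\<^sup>2" using assms by (intro abs_le_square_iff[THEN iffD1]) auto
  moreover have "C\<^sup>2 \<le> (A + B)\<^sup>2" using assms C by (intro power_mono) auto
  ultimately have "-1 \<le> k" "k \<le> 1"
    using assms(1,2) by (simp_all add: k_def field_simps power2_eq_square)
  then have cos: "cos (arccos k) = k" by (rule cos_arccos)
  have sc: "B\<^sup>2 * (sin (arccos k))\<^sup>2 + B\<^sup>2 * (cos (arccos k))\<^sup>2 = B\<^sup>2"
    by (simp only: distrib_left[symmetric] sin_cos_squared_add mult_1_right)
  have "(norm (w - of_real A))\<^sup>2
      = A\<^sup>2 + (B\<^sup>2 * (sin (arccos k))\<^sup>2 + B\<^sup>2 * (cos (arccos k))\<^sup>2) - 2 * A * B * cos (arccos k)"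
    unfolding cmod_power2 by (simp add: w_def power2_eq_square algebra_simps)
  also have "\<dots> = A\<^sup>2 + B\<^sup>2 - 2 * A * B * cos (arccos k)" by (simp only: sc)
  also have "\<dots> = A\<^sup>2 + B\<^sup>2 - 2 * A * B * k" by (simp only: cos)
  also have "\<dots> = C\<^sup>2" using assms(1,2) by (simp add: k_def)
  finally have "norm (w - of_real A) = C" using C by (simp add: power2_eq_iff_nonneg)
  then have "dist (of_real A :: complex) 0 = A" "dist 0 w = B" "dist w (of_real A) = C"
    using assms(1,2) by (simp_all add: w_def norm_mult dist_norm)
  then show thesis by (rule that)
qed

text \<open>The comparison triangle of the end points and the middle point is degenerate, because two points close
  to its middle corner, one on each side, are as far apart as if its angle there were \<open>\<pi>\<close>.\<close>

lemma CAT0_concat_dist: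
  assumes "CAT0 X d" and r: "r > 0" and im: "\<beta> ` {a..c} \<subseteq> X" and "a < b" "b < c"
    and ab: "const_speed_on d r \<beta> {a..b}" and bc: "const_speed_on d r \<beta> {b..c}"
    and \<eta>: "\<eta> > 0" "const_speed_on d r \<beta> {b - \<eta><..<b + \<eta>}"
  shows "d (\<beta> a) (\<beta> c) = r * (c - a)"
proof -
  interpret Metric_space X d using assms(1) by (simp add: CAT0_def)
  define x y z where "x = \<beta> a" and "y = \<beta> b" and "z = \<beta> c"
  have X: "x \<in> X" "y \<in> X" "z \<in> X" using im \<open>a < b\<close> \<open>b < c\<close> by (auto simp: x_def y_def z_def)
  have dxy: "d x y = r * (b - a)" and dyz: "d y z = r * (c - b)"
    using ab bc \<open>a < b\<close> \<open>b < c\<close> by (auto simp: const_speed_on_def x_def y_def z_def)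
  have c1: "is_geodesic X d (\<lambda>s. \<beta> (a + s * (b - a))) x y"
    unfolding x_def y_def by (rule const_speed_on_imp_geodesic) (use ab im \<open>a < b\<close> \<open>b < c\<close> in auto)
  have c2: "is_geodesic X d (\<lambda>s. \<beta> (b + s * (c - b))) y z"
    unfolding y_def z_def by (rule const_speed_on_imp_geodesic) (use bc im \<open>a < b\<close> \<open>b < c\<close> in auto)
  obtain c3 where c3: "is_geodesic X d c3 z x"
    using assms(1) X unfolding CAT0_def by meson
  obtain p q w :: complex where pq: "dist p q = d x y" "dist q w = d y z" "dist w p = d z x"
    using euclidean_triangle_exists[of "d x y" "d y z" "d z x"]
      triangle[of x y z] triangle[of y z x] triangle[of z x y] X commute
      dxy dyz r \<open>a < b\<close> \<open>b < c\<close> by (metis diff_gt_0_iff_gt mult_pos_pos)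
  \<comment> \<open>The points with parameters \<open>b - \<epsilon>\<close> and
    \<open>b + \<epsilon>\<close> have to lie in the window where the speed across \<open>b\<close>
    is known, and on the two given sides of the triangle.\<close>
  define \<epsilon> where "\<epsilon> = min (\<eta> / 2) (min (b - a) (c - b))"
  have e: "\<epsilon> > 0" "\<epsilon> < \<eta>" "\<epsilon> \<le> b - a" "\<epsilon> \<le> c - b"
    using \<eta> \<open>a < b\<close> \<open>b < c\<close> by (auto simp: \<epsilon>_def)
  define s t where "s = 1 - \<epsilon> / (b - a)" and "t = \<epsilon> / (c - b)"
  have st: "s \<in> {0..1}" "t \<in> {0..1}" using e \<open>a < b\<close> \<open>b < c\<close> by (auto simp: s_def t_def)
  have s': "a + s * (b - a) = b - \<epsilon>" and t': "b + t * (c - b) = b + \<epsilon>"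
    using \<open>a < b\<close> \<open>b < c\<close> by (auto simp: s_def t_def field_simps)
  have "d (\<beta> (a + s * (b - a))) (\<beta> (b + t * (c - b))) \<le> dist (linepath p q s) (linepath q w t)"
    using assms(1) c1 c2 c3 pq st unfolding CAT0_def comparison_pairs_def by fast
  moreover have "d (\<beta> (b - \<epsilon>)) (\<beta> (b + \<epsilon>)) = r * (2 * \<epsilon>)"
    using \<eta>(2) e by (auto simp: const_speed_on_def)
  ultimately have ineq: "r * (2 * \<epsilon>) \<le> norm (linepath p q s - linepath q w t)"
    by (simp add: s' t' dist_norm)
  define u v where "u = p - q" and "v = q - w"
  have nu: "norm u = r * (b - a)" and nv: "norm v = r * (c - b)"
    using pq dxy dyz by (auto simp: u_def v_def dist_norm)
  have "linepath p q s - linepath q w t = (\<epsilon> / (b - a)) *\<^sub>R u + (\<epsilon> / (c - b)) *\<^sub>R v"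
    by (simp add: linepath_def s_def t_def u_def v_def algebra_simps)
  with ineq have ineq2: "r * (2 * \<epsilon>) \<le> norm ((\<epsilon> / (b - a)) *\<^sub>R u + (\<epsilon> / (c - b)) *\<^sub>R v)"
    by simp
  define u' v' where "u' = (\<epsilon> / (b - a)) *\<^sub>R u" and "v' = (\<epsilon> / (c - b)) *\<^sub>R v"
  have n: "norm u' = r * \<epsilon>" "norm v' = r * \<epsilon>"
    using nu nv \<open>a < b\<close> \<open>b < c\<close> e by (auto simp: u'_def v'_def)
  \<comment> \<open>Equality in the triangle inequality: both vectors have length
    \<open>r * \<epsilon>\<close>, and their sum has at least twice that length. So they are
    parallel, and, being of equal length, they coincide.\<close>
  then have "norm (u' + v') = norm u' + norm v'"
    using norm_triangle_ineq[of u' v'] ineq2 unfolding u'_def[symmetric] v'_def[symmetric] by linarith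
  then have "norm u' *\<^sub>R v' = norm v' *\<^sub>R u'"
    by (simp only: norm_triangle_eq)
  then have "(r * \<epsilon>) *\<^sub>R v' = (r * \<epsilon>) *\<^sub>R u'"
    unfolding n .
  then have "v' = u'" using r e(1) by simp
  moreover have "p - w = ((b - a) / \<epsilon>) *\<^sub>R u' + ((c - b) / \<epsilon>) *\<^sub>R v'"
    using e(1) \<open>a < b\<close> \<open>b < c\<close> by (simp add: u'_def v'_def u_def v_def)
  ultimately have "p - w = ((b - a) / \<epsilon> + (c - b) / \<epsilon>) *\<^sub>R u'"
    by (simp only: scaleR_add_left)
  then have "p - w = ((c - a) / \<epsilon>) *\<^sub>R u'"
    by (simp add: add_divide_distrib[symmetric])
  then have "norm (p - w) = r * (c - a)"
    using n(1) e(1) \<open>a < b\<close> \<open>b < c\<close> by simp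
  then show ?thesis using pq(3) by (simp add: dist_norm norm_minus_commute commute x_def z_def)
qed

theorem CAT0_local_geodesic:
  assumes "CAT0 X d" and r: "r > 0" and im: "\<beta> ` {a..c} \<subseteq> X" and "a \<le> c"
    and local: "\<And>b. b \<in> {a..c} \<Longrightarrow> \<exists>\<eta>>0. const_speed_on d r \<beta> {b - \<eta><..<b + \<eta>}"
  shows "const_speed_on d r \<beta> {a..c}"
proof -
  interpret Metric_space X d using assms(1) by (simp add: CAT0_def)
  have "const_speed_on d r \<beta> ({a..c} \<inter> {a..c})"
    using \<open>a \<le> c\<close>
  \<comment> \<open>The rule pastes arbitrary intervals, also ones that leave \<open>{a..c}\<close>.
    After intersecting with \<open>{a..c}\<close>, a pasting point strictly between two admissible
    parameters lies in \<open>{a..c}\<close>, where the local hypothesis holds.\<close>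
  proof (rule Bolzano[where P = "\<lambda>s t. const_speed_on d r \<beta> ({s..t} \<inter> {a..c})"])
    fix s t u
    assume st: "const_speed_on d r \<beta> ({s..t} \<inter> {a..c})" and tu: "const_speed_on d r \<beta> ({t..u} \<inter> {a..c})"
      and "s \<le> t" "t \<le> u"
    have key: "d (\<beta> x) (\<beta> y) = r * (y - x)" if "x \<in> {s..t} \<inter> {a..c}" "y \<in> {t..u} \<inter> {a..c}" for x y
    proof (cases "x < t \<and> t < y")
      case True
      have "t \<in> {a..c}" using that by auto
      then obtain \<eta> where \<eta>: "\<eta> > 0" "const_speed_on d r \<beta> {t - \<eta><..<t + \<eta>}" using local by blast
      show ?thesis
      proof (rule CAT0_concat_dist[OF assms(1) r, of \<beta> x y t \<eta>])
        show "const_speed_on d r \<beta> {x..t}" "const_speed_on d r \<beta> {t..y}"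
          using st tu that by (auto simp: const_speed_on_def)
        show "\<beta> ` {x..y} \<subseteq> X" using im that by auto
      qed (use True \<eta> in auto)
    next
      case False
      then have "x = t \<or> y = t" using that by auto
      then show ?thesis using st tu that by (auto simp: const_speed_on_def)
    qed
    show "const_speed_on d r \<beta> ({s..u} \<inter> {a..c})"
      unfolding const_speed_on_def
    proof (intro ballI)
      fix x y assume xy: "x \<in> {s..u} \<inter> {a..c}" "y \<in> {s..u} \<inter> {a..c}"
      consider "x \<le> t" "y \<le> t" | "t \<le> x" "t \<le> y" | "x \<le> t" "t \<le> y" | "y \<le> t" "t \<le> x" by linarith
      then show "d (\<beta> x) (\<beta> y) = r * \<bar>x - y\<bar>"
      proof cases
        case 1 with st xy show ?thesis by (auto simp: const_speed_on_def)
      next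
        case 2 with tu xy show ?thesis by (auto simp: const_speed_on_def)
      next
        case 3 with key[of x y] xy show ?thesis by auto
      next
        case 4 with key[of y x] xy show ?thesis by (auto simp: commute)
      qed
    qed
  next
    fix b assume "a \<le> b" "b \<le> c"
    then obtain \<eta> where "\<eta> > 0" "const_speed_on d r \<beta> {b - \<eta><..<b + \<eta>}" using local by auto
    then show "\<exists>\<delta>>0. \<forall>s t. s \<le> b \<and> b \<le> t \<and> t - s < \<delta> \<longrightarrow> const_speed_on d r \<beta> ({s..t} \<inter> {a..c})"
      by (intro exI[of _ \<eta>]) (auto simp: const_speed_on_def)
  qed
  then show ?thesis by simp
qed

lemma local_Lipschitz_imp_Lipschitz:
  assumes "Metric_space X d" and im: "\<beta> ` {a..b} \<subseteq> X" and "a \<le> b"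
    and local: "\<And>t. t \<in> {a..b} \<Longrightarrow> \<exists>\<eta>>0. \<forall>x y. t - \<eta> < x \<and> x \<le> y \<and> y < t + \<eta> \<longrightarrow> d (\<beta> x) (\<beta> y) \<le> r * (y - x)"
  shows "d (\<beta> a) (\<beta> b) \<le> r * (b - a)"
proof -
  interpret Metric_space X d by fact
  have "a \<le> a \<and> b \<le> b \<longrightarrow> d (\<beta> a) (\<beta> b) \<le> r * (b - a)"
    using \<open>a \<le> b\<close>
  proof (rule Bolzano[where P = "\<lambda>s t. a \<le> s \<and> t \<le> b \<longrightarrow> d (\<beta> s) (\<beta> t) \<le> r * (t - s)"])
    fix s t u assume *: "a \<le> s \<and> t \<le> b \<longrightarrow> d (\<beta> s) (\<beta> t) \<le> r * (t - s)"
      "a \<le> t \<and> u \<le> b \<longrightarrow> d (\<beta> t) (\<beta> u) \<le> r * (u - t)" "s \<le> t" "t \<le> u"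
    show "a \<le> s \<and> u \<le> b \<longrightarrow> d (\<beta> s) (\<beta> u) \<le> r * (u - s)"
    proof
      assume su: "a \<le> s \<and> u \<le> b"
      then have "d (\<beta> s) (\<beta> u) \<le> d (\<beta> s) (\<beta> t) + d (\<beta> t) (\<beta> u)"
        using im * by (intro triangle) auto
      also have "\<dots> \<le> r * (t - s) + r * (u - t)" using * su by auto
      finally show "d (\<beta> s) (\<beta> u) \<le> r * (u - s)" by (simp add: algebra_simps)
    qed
  next
    fix t assume "a \<le> t" "t \<le> b"
    then obtain \<eta> where "\<eta> > 0" and \<eta>: "\<And>x y. t - \<eta> < x \<Longrightarrow> x \<le> y \<Longrightarrow> y < t + \<eta> \<Longrightarrow> d (\<beta> x) (\<beta> y) \<le> r * (y - x)"
      using local[of t] by auto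
    then show "\<exists>\<delta>>0. \<forall>x y. x \<le> t \<and> t \<le> y \<and> y - x < \<delta> \<longrightarrow> a \<le> x \<and> y \<le> b \<longrightarrow> d (\<beta> x) (\<beta> y) \<le> r * (y - x)"
      by (intro exI[of _ \<eta>]) auto
  qed
  then show ?thesis by simp
qed

text \<open>A curve that \<open>h\<close> translates by 1 is an axis as soon as it is a local geodesic on one period; its
  parameter is shifted so that the period is covered by the two halves around \<open>0\<close> and \<open>1 / 2\<close>.\<close>

lemma CAT0_axis:
  assumes "CAT0 X d" and r: "r > 0"
    and h: "h ` X \<subseteq> X" "\<And>x y. x \<in> X \<Longrightarrow> y \<in> X \<Longrightarrow> d (h x) (h y) = d x y"
    and E: "E ` {-1/2..1/2} \<subseteq> X" "E (1/2) = h (E (-1/2))"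
    and E_local: "\<And>t. t \<in> {-1/4..1/4} \<Longrightarrow> \<exists>\<eta>>0. const_speed_on d r E {t - \<eta><..<t + \<eta>}"
    and F_local: "\<And>t. t \<in> {-1/4..1/4} \<Longrightarrow>
      \<exists>\<eta>>0. const_speed_on d r (\<lambda>t. if t \<le> 0 then E (t + 1/2) else h (E (t - 1/2))) {t - \<eta><..<t + \<eta>}"
  shows "d (E (-1/4)) ((h ^^ n) (E (-1/4))) = r * n"
proof -
  interpret Metric_space X d using assms(1) by (simp add: CAT0_def)
  define F where "F = (\<lambda>t. if t \<le> 0 then E (t + 1/2) else h (E (t - 1/2)))"
  \<comment> \<open>The concatenation of the translates of \<open>E\<close>: on the period centred
    at the integer \<open>n\<close> it is \<open>E\<close> followed by \<open>h ^^ n\<close>. Only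
    nonnegative powers occur, so this is meaningful from -1/2 on; starting at -1/4 leaves room for a
    neighbourhood of the first parameter.\<close>
  define \<beta> where "\<beta> t = (h ^^ nat \<lfloor>t + 1/2\<rfloor>) (E (t - of_int \<lfloor>t + 1/2\<rfloor>))" for t :: real
  have hX: "h x \<in> X" if "x \<in> X" for x using h(1) that by blast
  have EX: "E t \<in> X" if "t \<in> {-1/2..1/2}" for t using E(1) that by blast
  have hnX: "(h ^^ n) x \<in> X" if "x \<in> X" for x n
    using that hX by (induction n) auto
  have hnd: "d ((h ^^ n) x) ((h ^^ n) y) = d x y" if "x \<in> X" "y \<in> X" for x y n
    using that hnX h(2) by (induction n) auto
  have FX: "F t \<in> X" if "t \<in> {-1/2..1/2}" for t
    using that EX hX by (auto simp: F_def)
  have \<beta>E: "\<beta> (real n + t) = (h ^^ n) (E t)" if "-1/2 \<le> t" "t < 1/2" for n t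
  proof -
    have "\<lfloor>real n + t + 1/2\<rfloor> = int n" using that by (intro floor_unique) auto
    then show ?thesis by (simp add: \<beta>_def)
  qed
  have \<beta>F: "\<beta> (real n + 1/2 + t) = (h ^^ n) (F t)" if "-1/2 < t" "t < 1/2" for n t
  proof (cases "t < 0")
    case True
    then show ?thesis using \<beta>E[of "t + 1/2" n] that by (simp add: F_def add.commute add.left_commute)
  next
    case False
    have "\<beta> (real n + 1/2 + t) = (h ^^ Suc n) (E (t - 1/2))"
      using \<beta>E[of "t - 1/2" "Suc n"] that False by (simp add: algebra_simps)
    also have "\<dots> = (h ^^ n) (F t)"
      \<comment> \<open>At \<open>t = 0\<close> the two descriptions use different translates of
        \<open>E\<close>; they match because \<open>h\<close> takes the initial point of
        \<open>E\<close> to its final point.\<close>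
      using False E(2) by (cases "t = 0") (auto simp: F_def funpow_swap1)
    finally show ?thesis .
  qed
  have transfer: "\<exists>\<eta>>0. const_speed_on d r \<beta> {b - \<eta><..<b + \<eta>}"
    if t: "t \<in> {-1/4..1/4}" "b = m + t"
      and G: "\<exists>\<eta>>0. const_speed_on d r G {t - \<eta><..<t + \<eta>}"
      "\<And>s. -1/2 < s \<Longrightarrow> s < 1/2 \<Longrightarrow> G s \<in> X" "\<And>s. -1/2 < s \<Longrightarrow> s < 1/2 \<Longrightarrow> \<beta> (m + s) = (h ^^ n) (G s)"
    for b m t n G
  proof -
    obtain \<eta> where \<eta>: "\<eta> > 0" "const_speed_on d r G {t - \<eta><..<t + \<eta>}" using G(1) by blast
    have "d (\<beta> x) (\<beta> y) = r * \<bar>x - y\<bar>" if "x \<in> {b - min \<eta> (1/4)<..<b + min \<eta> (1/4)}"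
      "y \<in> {b - min \<eta> (1/4)<..<b + min \<eta> (1/4)}" for x y
    proof -
      have *: "-1/2 < x - m" "x - m < 1/2" "-1/2 < y - m" "y - m < 1/2"
        "x - m \<in> {t - \<eta><..<t + \<eta>}" "y - m \<in> {t - \<eta><..<t + \<eta>}"
        using that t by auto
      have "d (\<beta> x) (\<beta> y) = d ((h ^^ n) (G (x - m))) ((h ^^ n) (G (y - m)))"
        using G(3)[OF *(1,2)] G(3)[OF *(3,4)] by simp
      also have "\<dots> = r * \<bar>x - y\<bar>"
        using hnd[OF G(2)[OF *(1,2)] G(2)[OF *(3,4)]] \<eta>(2) *(5,6) unfolding const_speed_on_def by fastforce
      finally show ?thesis .
    qed
    then show ?thesis using \<eta>(1) unfolding const_speed_on_def by (intro exI[of _ "min \<eta> (1/4)"]) auto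
  qed
  \<comment> \<open>Parameters within 1/4 of an integer will be treated with \<open>E\<close>, the
    remaining ones, which are within 1/4 of a half-integer, with \<open>F\<close>.\<close>
  have nonneg: "\<exists>k s. b = real k + s \<and> -1/4 \<le> s \<and> s < 3/4" if "-1/4 \<le> b" for b :: real
    using that by (intro exI[of _ "nat \<lfloor>b + 1/4\<rfloor>"] exI[of _ "b - nat \<lfloor>b + 1/4\<rfloor>"]) (auto; linarith)
  have "const_speed_on d r \<beta> {-1/4..real n - 1/4}"
  proof (cases n)
    case 0
    then show ?thesis using r \<beta>E[of "-1/4" 0] EX[of "-1/4"] by (auto simp: const_speed_on_def)
  next
    case (Suc m)
    show ?thesis
    proof (rule CAT0_local_geodesic[OF assms(1) r])
      fix b :: real assume "b \<in> {-1/4..real n - 1/4}"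
      then obtain k s where ks: "b = real k + s" "-1/4 \<le> s" "s < 3/4" using nonneg[of b] by auto
      show "\<exists>\<eta>>0. const_speed_on d r \<beta> {b - \<eta><..<b + \<eta>}"
      proof (cases "s \<le> 1/4")
        case True
        show ?thesis
          by (rule transfer[of s b "real k" E k]) (use ks True E_local EX \<beta>E in auto)
      next
        case False
        show ?thesis
          by (rule transfer[of "s - 1/2" b "real k + 1/2" F k]) (use ks False F_local FX \<beta>F in \<open>auto simp: F_def\<close>)
      qed
    next
      show "\<beta> ` {-1/4..real n - 1/4} \<subseteq> X"
      proof (rule image_subsetI)
        fix b :: real assume "b \<in> {-1/4..real n - 1/4}"
        then obtain k s where ks: "b = real k + s" "-1/4 \<le> s" "s < 3/4" using nonneg[of b] by auto
        show "\<beta> b \<in> X"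
        proof (cases "s \<le> 1/4")
          case True
          then show ?thesis using \<beta>E[of s k] ks EX[of s] hnX by auto
        next
          case False
          then show ?thesis using \<beta>F[of "s - 1/2" k] ks FX[of "s - 1/2"] hnX by (auto simp: add.commute)
        qed
      qed
    qed (use Suc in auto)
  qed
  then have "d (\<beta> (-1/4)) (\<beta> (real n - 1/4)) = r * n" by (auto simp: const_speed_on_def)
  then show ?thesis using \<beta>E[of "-1/4" 0] \<beta>E[of "-1/4" n] by simp
qed

section \<open>The metric of K\<close>

text \<open>The source of all lower bounds for the metric of \<open>K\<close>: a function compatible
  with the gluing and 1-Lipschitz on each triangle changes, along a string, by at most the length of
  the string.\<close>

lemma K_string_Lipschitz:
  fixes U :: "triangle \<times> complex \<Rightarrow> real"
  assumes inv: "\<And>p q. (p, q) \<in> glue_sides \<Longrightarrow> U p = U q"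
    and lip: "\<And>\<tau> z w. \<tau> \<in> K_triangles \<Longrightarrow> z \<in> std_triangle \<Longrightarrow> w \<in> std_triangle \<Longrightarrow> \<bar>U (\<tau>, z) - U (\<tau>, w)\<bar> \<le> dist z w"
    and "K_string P Q r"
    and "\<tau> \<in> K_triangles" "z \<in> std_triangle" "P = K_pt \<tau> z"
    and "\<tau>' \<in> K_triangles" "z' \<in> std_triangle" "Q = K_pt \<tau>' z'"
  shows "\<bar>U (\<tau>, z) - U (\<tau>', z')\<bar> \<le> r"
proof -
  have U_eq: "U (\<tau>, z) = U (\<tau>', z')"
    if "\<tau> \<in> K_triangles" "z \<in> std_triangle" "\<tau>' \<in> K_triangles" "z' \<in> std_triangle" "K_pt \<tau> z = K_pt \<tau>' z'" for \<tau> z \<tau>' z'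
  proof -
    have "((\<tau>, z), (\<tau>', z')) \<in> glue_sides\<^sup>*"
      using that by (simp add: K_pt_eq_iff glue_def)
    then show ?thesis
      by (induction rule: rtrancl_induct) (auto simp: inv)
  qed
  from assms(3-) show ?thesis
  proof (induction arbitrary: \<tau> z rule: K_string.induct)
    case (Nil P)
    then show ?case using U_eq[of \<tau> z \<tau>' z'] by simp
  next
    case (Cons \<sigma> x y Q r)
    have "U (\<tau>, z) = U (\<sigma>, x)" using Cons by (intro U_eq) auto
    moreover have "\<bar>U (\<sigma>, y) - U (\<tau>', z')\<bar> \<le> r" using Cons by blast
    moreover have "\<bar>U (\<sigma>, x) - U (\<sigma>, y)\<bar> \<le> dist x y" using Cons lip by blast
    ultimately show ?case by linarith
  qed
qed

lemma K_string_nonneg: "K_string P Q r \<Longrightarrow> 0 \<le> r"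
  by (induction rule: K_string.induct) auto

lemma K_string_triangle:
  "\<tau> \<in> K_triangles \<Longrightarrow> z \<in> std_triangle \<Longrightarrow> w \<in> std_triangle \<Longrightarrow> K_string (K_pt \<tau> z) (K_pt \<tau> w) (dist z w)"
  using K_string.Cons[of \<tau> z w "K_pt \<tau> w" 0] K_string.Nil by simp

lemma K_string_append: "K_string P Q r \<Longrightarrow> K_string Q R s \<Longrightarrow> K_string P R (r + s)"
  by (induction rule: K_string.induct) (auto simp: add.assoc intro: K_string.Cons)

lemma K_string_exists: "\<exists>r. K_string P Q r"
proof -
  obtain \<tau> z where P: "\<tau> \<in> K_triangles" "z \<in> std_triangle" "P = K_pt \<tau> z" by (rule K_pt_cases)
  obtain \<sigma> w where Q: "\<sigma> \<in> K_triangles" "w \<in> std_triangle" "Q = K_pt \<sigma> w" by (rule K_pt_cases)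
  have "K_pt \<tau> 0 = K_pt \<sigma> 0" using P(1) Q(1) by (simp add: K_single_vertex)
  then show ?thesis
    using K_string_append[OF K_string_triangle[OF P(1,2) zero_in_std_triangle]]
      K_string_triangle[OF Q(1) zero_in_std_triangle Q(2)] P(3) Q(3) by metis
qed

lemma K_dist_le: "K_string P Q r \<Longrightarrow> K_dist P Q \<le> r"
  unfolding K_dist_def by (rule cInf_lower) (auto intro: K_string_nonneg bdd_belowI)

lemma K_dist_ge:
  fixes U :: "triangle \<times> complex \<Rightarrow> real"
  assumes "\<And>p q. (p, q) \<in> glue_sides \<Longrightarrow> U p = U q"
    and "\<And>\<tau> z w. \<tau> \<in> K_triangles \<Longrightarrow> z \<in> std_triangle \<Longrightarrow> w \<in> std_triangle \<Longrightarrow> \<bar>U (\<tau>, z) - U (\<tau>, w)\<bar> \<le> dist z w"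
    and "\<tau> \<in> K_triangles" "z \<in> std_triangle" "\<tau>' \<in> K_triangles" "z' \<in> std_triangle"
  shows "\<bar>U (\<tau>, z) - U (\<tau>', z')\<bar> \<le> K_dist (K_pt \<tau> z) (K_pt \<tau>' z')"
  unfolding K_dist_def
proof (rule cInf_greatest)
  show "{r. K_string (K_pt \<tau> z) (K_pt \<tau>' z') r} \<noteq> {}" by (simp add: K_string_exists)
qed (use K_string_Lipschitz[OF assms(1,2)] assms(3-) in blast)

text \<open>Being a corner is invariant under the gluing, since a point of a side is a corner
  exactly at the parameters 0 and 1.\<close>

lemma K_pt_eq_vertex:
  assumes "\<tau> \<in> K_triangles" "z \<in> std_triangle" "K_pt \<tau> z = K_vertex"
  shows "z \<in> {0, 1, cis (pi / 3)}"
proof -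
  have inv: "(snd p \<in> {0, 1, cis (pi / 3)}) = (snd q \<in> {0, 1, cis (pi / 3)})" if pq: "(p, q) \<in> glue_sides" for p q
  proof -
    have side: "g s \<in> {0, 1, cis (pi / 3)} \<longleftrightarrow> s \<in> {0, 1}" if "(l, g) \<in> sides \<tau>" "s \<in> {0..1}" for l g \<tau> s
    proof -
      have "Im (cis (pi / 3)) \<noteq> 0" by (simp add: sin_60)
      then show ?thesis
        using that by (cases \<tau>) (auto simp: linepath_def complex_eq_iff cos_60 sin_60)
    qed
    from pq obtain \<tau> \<tau>' l g g' s where "p = (\<tau>, g s)" "q = (\<tau>', g' s)" "(l, g) \<in> sides \<tau>" "(l, g') \<in> sides \<tau>'" "s \<in> {0..1}"
      unfolding glue_sides_def by blast
    then show ?thesis using side[of l g \<tau> s] side[of l g' \<tau>' s] by simp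
  qed
  have tri: "(La, Le, Lt1) \<in> K_triangles" by (simp add: K_triangles_def Y_triangles_def)
  have "(((La, Le, Lt1), 0), (\<tau>, z)) \<in> glue_sides\<^sup>*"
    using assms tri zero_in_std_triangle K_pt_eq_iff[of "(La, Le, Lt1)" 0 \<tau> z] by (simp add: K_vertex_def glue_def)
  then have "(0::complex) \<in> {0, 1, cis (pi / 3)} \<longleftrightarrow> z \<in> {0, 1, cis (pi / 3)}"
  proof (induction "(\<tau>, z)" arbitrary: \<tau> z rule: rtrancl_induct)
    case (step q)
    then show ?case using inv[OF step(2)] by (metis prod.collapse snd_conv)
  qed auto
  then show ?thesis by blast
qed

section \<open>Unfolding the triangles at an edge\<close>

fun labels :: "triangle \<Rightarrow> loop_label set" where
  "labels (u, v, w) = {u, v, w}"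

text \<open>The isometry of the triangle onto itself that takes the side labelled \<open>l\<close> to the segment from 0 to 1,
  respecting the parametrisation.\<close>

fun chart :: "loop_label \<Rightarrow> triangle \<Rightarrow> complex \<Rightarrow> complex" where
  "chart l (u, v, w) z =
     (if l = u then z else if l = v then (1 - z) * cis (pi / 3) else cnj z * cis (pi / 3))"

lemma dist_chart: "dist (chart l \<tau> z) (chart l \<tau> w) = dist z w"
proof -
  have "cmod (cnj z - cnj w) = cmod (z - w)" by (metis complex_cnj_diff complex_mod_cnj)
  then show ?thesis
    by (cases \<tau>) (auto simp: dist_norm left_diff_distrib[symmetric] norm_mult norm_minus_commute)
qed

text \<open>The lines through the two upper sides are at distance \<open>sqrt 3 / 4\<close> from the
  midpoint of the base, and 2/5 is a convenient rational number below this.\<close>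

lemma norm_60_ge:
  "2 / 5 \<le> cmod (complex_of_real s * cis (pi / 3) - 1 / 2)"
  "2 / 5 \<le> cmod (1 + complex_of_real s * (cis (pi / 3) - 1) - 1 / 2)"
proof -
  have sq: "2 / 5 \<le> cmod z" if "(cmod z)\<^sup>2 = x\<^sup>2 + 3/16" for z x
  proof (rule power2_le_imp_le)
    have "(2 / 5)\<^sup>2 \<le> (3 / 16 :: real)" by (simp add: power2_eq_square)
    then show "(2 / 5)\<^sup>2 \<le> (cmod z)\<^sup>2" unfolding that using zero_le_power2[of x] by linarith
  qed simp
  show "2 / 5 \<le> cmod (complex_of_real s * cis (pi / 3) - 1 / 2)"
    by (rule sq[of _ "s - 1/4"]) (simp add: cmod_power2, simp add: cos_60 sin_60 power2_eq_square algebra_simps)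
  show "2 / 5 \<le> cmod (1 + complex_of_real s * (cis (pi / 3) - 1) - 1 / 2)"
    by (rule sq[of _ "s - 1/4"]) (simp add: cmod_power2, simp add: cos_60 sin_60 power2_eq_square algebra_simps)
qed

lemma K_triangles_distinct: "(u, v, w) \<in> K_triangles \<Longrightarrow> u \<noteq> v \<and> u \<noteq> w \<and> v \<noteq> w"
  by (auto simp: K_triangles_def Y_triangles_def)

lemma chart_side:
  assumes "(l, g) \<in> sides \<tau>" "\<tau> \<in> K_triangles"
  shows "chart l \<tau> (g s) = of_real s"
proof -
  obtain u v w where \<tau>: "\<tau> = (u, v, w)" by (cases \<tau>)
  show ?thesis
    using assms K_triangles_distinct[of u v w] unfolding \<tau>
    by (auto simp: linepath_def complex_eq_iff cos_60 sin_60 field_simps)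
qed

lemma chart_other_side:
  assumes "(l', g) \<in> sides \<tau>" "\<tau> \<in> K_triangles" "l \<in> labels \<tau>" "l \<noteq> l'"
  shows "2 / 5 \<le> cmod (chart l \<tau> (g s) - 1 / 2)"
proof -
  obtain u v w where \<tau>: "\<tau> = (u, v, w)" by (cases \<tau>)
  have "chart l \<tau> (g s) \<in> {of_real s * cis (pi / 3), of_real (1 - s) * cis (pi / 3),
      1 + of_real s * (cis (pi / 3) - 1), 1 + of_real (1 - s) * (cis (pi / 3) - 1)}"
    using assms K_triangles_distinct[of u v w] unfolding \<tau>
    by (auto simp: linepath_def complex_eq_iff cos_60 sin_60 field_simps)
  then show ?thesis
    using norm_60_ge[of s] norm_60_ge[of "1 - s"] by (elim insertE emptyE) simp_all
qed

lemma chart_corner: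
  assumes "z \<in> {0, 1, cis (pi / 3)}"
  shows "chart l \<tau> z \<in> {0, 1, cis (pi / 3)}"
  using assms by (cases \<tau>; elim insertE emptyE; hypsubst) (auto simp: complex_eq_iff cos_60 sin_60)

text \<open>A truncated distance function of the star of the edge \<open>l\<close>, in which the triangle \<open>\<tau>0\<close> is unfolded to
  the lower half-plane and every other triangle at that edge to the upper one.\<close>

definition bump :: "loop_label \<Rightarrow> triangle \<Rightarrow> complex \<Rightarrow> real \<Rightarrow> triangle \<times> complex \<Rightarrow> real" where
  "bump l \<tau>0 w \<rho> = (\<lambda>(\<tau>, z). if l \<in> labels \<tau>
     then max 0 (\<rho> - dist (if \<tau> = \<tau>0 then cnj (chart l \<tau> z) else chart l \<tau> z) w) else 0)"

lemma cmod_cnj_diff: "cmod (cnj z - cnj w) = cmod (z - w)"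
  by (metis complex_cnj_diff complex_mod_cnj)

lemma cmod_cnj_diff_half: "cmod (cnj z - 1 / 2) = cmod (z - 1 / 2)"
  using cmod_cnj_diff[of z "1 / 2"] by simp

text \<open>On the edge \<open>l\<close> every chart gives the real number \<open>s\<close>, which
  conjugation fixes. On any other side the function vanishes: such a side is at distance at least
  2/5 from the midpoint of \<open>l\<close>, and the hypothesis on \<open>w\<close> and
  \<open>\<rho>\<close> keeps the support within that distance.\<close>

lemma bump_glue:
  assumes w: "dist w (1 / 2) + \<rho> \<le> 2 / 5" and pq: "(p, q) \<in> glue_sides"
  shows "bump l \<tau>0 w \<rho> p = bump l \<tau>0 w \<rho> q"
proof -
  have far: "max 0 (\<rho> - dist x w) = 0" if "2 / 5 \<le> cmod (x - 1 / 2)" for x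
    using that w dist_triangle[of x "1/2" w] by (simp add: dist_norm)
  have val: "bump l \<tau>0 w \<rho> (\<tau>, g s) = (if l' = l then max 0 (\<rho> - dist (of_real s) w) else 0)"
    if "(l', g) \<in> sides \<tau>" "\<tau> \<in> K_triangles" for l' g \<tau> s
  proof (cases "l' = l")
    case True
    have "l' \<in> labels \<tau>" using that(1) by (cases \<tau>) auto
    then show ?thesis using that chart_side[OF that] True by (cases "\<tau> = \<tau>0") (simp_all add: bump_def del: chart.simps)
  next
    case False
    then show ?thesis
      using chart_other_side[OF that, of l s] by (auto simp: bump_def far cmod_cnj_diff_half simp del: chart.simps)
  qed
  from pq obtain \<tau> \<tau>' l' g g' s where "p = (\<tau>, g s)" "q = (\<tau>', g' s)" "\<tau> \<in> K_triangles" "\<tau>' \<in> K_triangles"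
      "(l', g) \<in> sides \<tau>" "(l', g') \<in> sides \<tau>'"
    unfolding glue_sides_def by blast
  then show ?thesis by (simp add: val)
qed

lemma bump_Lipschitz: "\<bar>bump l \<tau>0 w \<rho> (\<tau>, z) - bump l \<tau>0 w \<rho> (\<tau>, z')\<bar> \<le> dist z z'"
proof -
  have max: "\<bar>max 0 (\<rho> - a) - max 0 (\<rho> - b)\<bar> \<le> \<bar>a - b\<bar>" for a b :: real by linarith
  have *: "\<bar>max 0 (\<rho> - dist x w) - max 0 (\<rho> - dist y w)\<bar> \<le> dist x y" for x y
    using max[of "dist x w" "dist y w"] dist_triangle[of x w y] dist_triangle[of y w x] by (simp add: dist_commute)
  have cnj: "dist (cnj x) (cnj y) = dist x y" for x y by (simp add: dist_norm cmod_cnj_diff)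
  show ?thesis
    using *[of "chart l \<tau> z" "chart l \<tau> z'"] *[of "cnj (chart l \<tau> z)" "cnj (chart l \<tau> z')"]
    by (cases "\<tau> = \<tau>0") (simp_all add: bump_def dist_chart cnj del: chart.simps)
qed

text \<open>A unit-speed segment that passes from \<open>\<sigma>\<close> (where it is \<open>z\<close>) to \<open>\<tau>\<close> (where it is \<open>w\<close>) through the midpoint of
  the common edge \<open>l\<close> at time 0, and becomes a straight line of direction \<open>e\<close> when the two triangles are unfolded.\<close>

definition crossing :: "loop_label \<Rightarrow> triangle \<Rightarrow> triangle \<Rightarrow> complex \<Rightarrow> (real \<Rightarrow> complex) \<Rightarrow> (real \<Rightarrow> complex) \<Rightarrow> bool" where
  "crossing l \<sigma> \<tau> e z w \<longleftrightarrow> \<sigma> \<in> K_triangles \<and> \<tau> \<in> K_triangles \<and> \<sigma> \<noteq> \<tau> \<and> l \<in> labels \<sigma> \<and> l \<in> labels \<tau> \<and> norm e = 1 \<and>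
     (\<forall>t\<in>{-1/2..0}. z t \<in> std_triangle \<and> cnj (chart l \<sigma> (z t)) = 1 / 2 + of_real t * e) \<and>
     (\<forall>t\<in>{0..1/2}. w t \<in> std_triangle \<and> chart l \<tau> (w t) = 1 / 2 + of_real t * e) \<and>
     K_pt \<sigma> (z 0) = K_pt \<tau> (w 0)"

definition crossing_pt :: "triangle \<Rightarrow> triangle \<Rightarrow> (real \<Rightarrow> complex) \<Rightarrow> (real \<Rightarrow> complex) \<Rightarrow> real \<Rightarrow> K" where
  "crossing_pt \<sigma> \<tau> z w t = (if t \<le> 0 then K_pt \<sigma> (z t) else K_pt \<tau> (w t))"

section \<open>Crossing segments have unit speed in \<open>K\<close>\<close>

lemma crossing_K_dist_le:
  assumes c: "crossing l \<sigma> \<tau> e z w" and st: "-1/2 \<le> s" "s \<le> t" "t \<le> 1/2"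
  shows "K_dist (crossing_pt \<sigma> \<tau> z w s) (crossing_pt \<sigma> \<tau> z w t) \<le> t - s"
proof (rule K_dist_le)
  have e: "norm (of_real a * e - of_real b * e) = b - a" if "a \<le> b" for a b
    using c that by (simp add: crossing_def left_diff_distrib[symmetric] norm_mult of_real_diff[symmetric] del: of_real_diff)
  have z: "dist (z a) (z b) = b - a" if "-1/2 \<le> a" "a \<le> b" "b \<le> 0" for a b
  proof -
    have "dist (z a) (z b) = norm (cnj (chart l \<sigma> (z a)) - cnj (chart l \<sigma> (z b)))"
      using dist_chart[of l \<sigma> "z a" "z b"] by (simp only: cmod_cnj_diff dist_norm)
    then show ?thesis using c that e[of a b] by (simp add: crossing_def del: chart.simps)
  qed
  have w: "dist (w a) (w b) = b - a" if "0 \<le> a" "a \<le> b" "b \<le> 1/2" for a b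
    using c that e[of a b] dist_chart[of l \<tau> "w a" "w b"] by (simp add: crossing_def dist_norm del: chart.simps)
  have zs: "K_string (K_pt \<sigma> (z a)) (K_pt \<sigma> (z b)) (b - a)" if "-1/2 \<le> a" "a \<le> b" "b \<le> 0" for a b
    using c that z[OF that] K_string_triangle[of \<sigma> "z a" "z b"] by (simp add: crossing_def)
  have ws: "K_string (K_pt \<tau> (w a)) (K_pt \<tau> (w b)) (b - a)" if "0 \<le> a" "a \<le> b" "b \<le> 1/2" for a b
    using c that w[OF that] K_string_triangle[of \<tau> "w a" "w b"] by (simp add: crossing_def)
  consider "t \<le> 0" | "0 < s" | "s \<le> 0" "0 < t" by linarith
  then show "K_string (crossing_pt \<sigma> \<tau> z w s) (crossing_pt \<sigma> \<tau> z w t) (t - s)"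
  proof cases
    case 1
    then show ?thesis using zs[of s t] st by (simp add: crossing_pt_def)
  next
    case 2
    then show ?thesis using ws[of s t] st by (simp add: crossing_pt_def)
  next
    case 3
    have "K_string (K_pt \<sigma> (z s)) (K_pt \<tau> (w t)) ((0 - s) + (t - 0))"
      using K_string_append[OF zs[of s 0]] ws[of 0 t] c st 3 by (simp add: crossing_def)
    then show ?thesis using 3 by (simp add: crossing_pt_def)
  qed
qed

text \<open>The bump is centred at the point of the unfolded line at time \<open>t0 - 1/20\<close>.
  From there on its value drops at unit speed along the line, before and after the edge alike. Its
  radius 1/10 is the length of the time window, and 1/4 + 1/20 + 1/10 = 2/5 is just what
  \<open>bump_glue\<close> allows.\<close>

lemma crossing_K_dist_ge:
  assumes c: "crossing l \<sigma> \<tau> e z w" and t0: "t0 \<in> {-1/4..1/4}"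
    and s: "t0 - 1/20 \<le> s" and st: "s \<le> t" and t: "t \<le> t0 + 1/20"
  shows "t - s \<le> K_dist (crossing_pt \<sigma> \<tau> z w s) (crossing_pt \<sigma> \<tau> z w t)"
proof -
  define x where "x = 1 / 2 + of_real (t0 - 1/20) * e"
  have ne: "norm e = 1" using c by (simp add: crossing_def)
  have x: "dist x (1 / 2) + 1 / 10 \<le> 2 / 5"
  proof -
    have "\<bar>t0 - 1/20\<bar> \<le> 3/10" unfolding abs_le_iff using t0 by auto
    then show ?thesis using ne by (simp add: x_def dist_norm norm_mult del: of_real_diff)
  qed
  define U where "U = bump l \<sigma> x (1 / 10)"
  have line: "dist (1 / 2 + of_real r * e) x = r - (t0 - 1/20)" if "t0 - 1/20 \<le> r" for r
  proof -
    have "dist (1 / 2 + of_real r * e) x = norm (of_real (r - (t0 - 1/20)) * e)"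
      by (simp add: x_def dist_norm algebra_simps)
    then show ?thesis using that ne by (simp add: norm_mult del: of_real_diff)
  qed
  have zU: "U (\<sigma>, z r) = 1 / 20 + t0 - r" if "t0 - 1/20 \<le> r" "r \<le> t0 + 1/20" "r \<le> 0" for r
    using c that t0 line[OF that(1)] by (simp add: U_def bump_def crossing_def del: chart.simps)
  have wU: "U (\<tau>, w r) = 1 / 20 + t0 - r" if "t0 - 1/20 \<le> r" "r \<le> t0 + 1/20" "0 \<le> r" for r
    using c that t0 line[OF that(1)] by (auto simp: U_def bump_def crossing_def simp del: chart.simps)
  have memz: "\<sigma> \<in> K_triangles" "z r \<in> std_triangle" if "t0 - 1/20 \<le> r" "r \<le> 0" for r
    using c that t0 by (auto simp: crossing_def)
  have memw: "\<tau> \<in> K_triangles" "w r \<in> std_triangle" if "r \<le> t0 + 1/20" "0 \<le> r" for r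
    using c that t0 by (auto simp: crossing_def)
  note ge = K_dist_ge[of U, OF bump_glue[OF x, of _ _ l \<sigma>, folded U_def] bump_Lipschitz[of l \<sigma> x "1/10", folded U_def]]
  consider "t \<le> 0" | "0 < s" | "s \<le> 0" "0 < t" by linarith
  then show ?thesis
  proof cases
    case 1
    then show ?thesis
      using ge[of \<sigma> "z s" \<sigma> "z t"] zU[of s] zU[of t] memz[of s] memz[of t] s st t by (simp add: crossing_pt_def)
  next
    case 2
    then show ?thesis
      using ge[of \<tau> "w s" \<tau> "w t"] wU[of s] wU[of t] memw[of s] memw[of t] s st t by (simp add: crossing_pt_def)
  next
    case 3
    then show ?thesis
      using ge[of \<sigma> "z s" \<tau> "w t"] zU[of s] wU[of t] memz[of s] memw[of t] s st t by (simp add: crossing_pt_def)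
  qed
qed

text \<open>The unfolded point is closer than 1/2 to the midpoint of the edge, while every corner is
  at least 1/2 away from it.\<close>

lemma crossing_pt_neq_vertex:
  assumes c: "crossing l \<sigma> \<tau> e z w" and t: "\<bar>t\<bar> < 1/2"
  shows "crossing_pt \<sigma> \<tau> z w t \<noteq> K_vertex"
proof
  assume eq: "crossing_pt \<sigma> \<tau> z w t = K_vertex"
  have corner: "1 / 2 \<le> cmod (x - 1 / 2)" if "x \<in> {0, 1, cis (pi / 3)}" for x
  proof -
    have "1 / 2 \<le> Im (cis (pi / 3) - 1 / 2)" using real_le_rsqrt[of 1 3] by (simp add: sin_60)
    then have "1 / 2 \<le> cmod (cis (pi / 3) - 1 / 2)" using abs_Im_le_cmod[of "cis (pi / 3) - 1 / 2"] by linarith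
    then show ?thesis using that by auto
  qed
  have near: "cmod (1 / 2 + of_real t * e - 1 / 2) < 1 / 2"
    using t c by (simp add: crossing_def norm_mult)
  show False
  proof (cases "t \<le> 0")
    case True
    then have "z t \<in> {0, 1, cis (pi / 3)}"
      using K_pt_eq_vertex[of \<sigma> "z t"] eq c t by (auto simp: crossing_def crossing_pt_def)
    then have "1 / 2 \<le> cmod (cnj (chart l \<sigma> (z t)) - 1 / 2)"
      unfolding cmod_cnj_diff_half by (intro corner chart_corner)
    then show False using near c t True by (simp add: crossing_def del: chart.simps)
  next
    case False
    then have "w t \<in> {0, 1, cis (pi / 3)}"
      using K_pt_eq_vertex[of \<tau> "w t"] eq c t by (auto simp: crossing_def crossing_pt_def)
    then have "1 / 2 \<le> cmod (chart l \<tau> (w t) - 1 / 2)"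
      by (intro corner chart_corner)
    then show False using near c t False by (simp add: crossing_def del: chart.simps)
  qed
qed

lemma std_triangle_mem:
  "a \<ge> 0 \<Longrightarrow> b \<ge> 0 \<Longrightarrow> a + b \<le> 1 \<Longrightarrow> of_real a + of_real b * cis (pi / 3) \<in> std_triangle"
  unfolding std_triangle_def convex_hull_3
  by (intro CollectI exI[of _ "1 - a - b"] exI[of _ a] exI[of _ b]) (auto simp: scaleR_conv_of_real)

text \<open>One of the two crossings that make up the midline of the strip: parallel to
  \<open>a\<close> from the \<open>t1\<close> side to the \<open>e\<close> side of the first
  triangle, then parallel to \<open>b\<close> back to the \<open>t1\<close> side in the second. All
  these points are midpoints of sides.\<close>

lemma crossing_e:
  "crossing Le (La, Le, Lt1) (Le, Lb, Lt1) (cis (pi / 3) - 1)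
     (\<lambda>t. of_real (1 / 2 + t) + of_real (1 / 2) * cis (pi / 3))
     (\<lambda>t. of_real (1 / 2 - t) + of_real t * cis (pi / 3))"
proof -
  have "linepath 1 (cis (pi / 3)) (1/2) = (1 + cis (pi / 3)) / 2" "linepath 0 1 (1/2) = (1/2 :: complex)"
    by (simp_all add: linepath_def complex_eq_iff field_simps)
  moreover have "K_pt (La, Le, Lt1) (linepath 1 (cis (pi / 3)) (1/2)) = K_pt (Le, Lb, Lt1) (linepath 0 1 (1/2))"
    by (rule K_pt_side[of _ _ Le]) (auto simp: K_triangles_def Y_triangles_def)
  ultimately have "K_pt (La, Le, Lt1) ((1 + cis (pi / 3)) / 2) = K_pt (Le, Lb, Lt1) (1 / 2)"
    by (simp only:)
  moreover have "cmod (cis (pi / 3) - 1) = 1"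
    by (simp add: cmod_def cos_60 sin_60 power2_eq_square)
  ultimately show ?thesis
    unfolding crossing_def
    by (intro conjI ballI std_triangle_mem)
      (auto simp: linepath_def scaleR_conv_of_real K_triangles_def Y_triangles_def complex_eq_iff cos_60 sin_60 field_simps)
qed

text \<open>The same two segments in the opposite order, each shifted in time by 1/2, so that the
  two crossings overlap to a periodic line.\<close>

lemma crossing_t:
  "crossing Lt1 (Le, Lb, Lt1) (La, Le, Lt1) (cis (pi / 3))
     (\<lambda>t. of_real (- t) + of_real (1 / 2 + t) * cis (pi / 3))
     (\<lambda>t. of_real t + of_real (1 / 2) * cis (pi / 3))"
proof -
  have "K_pt (Le, Lb, Lt1) (linepath 0 (cis (pi / 3)) (1/2)) = K_pt (La, Le, Lt1) (linepath 0 (cis (pi / 3)) (1/2))"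
    by (rule K_pt_side[of _ _ Lt1]) (auto simp: K_triangles_def Y_triangles_def)
  then show ?thesis
    unfolding crossing_def
    by (intro conjI ballI std_triangle_mem)
      (auto simp: linepath_def scaleR_conv_of_real K_triangles_def Y_triangles_def complex_eq_iff cos_60 sin_60 field_simps)
qed

section \<open>Curves in the universal cover\<close>

lemma continuous_on_K_pt: "\<tau> \<in> K_triangles \<Longrightarrow> continuous_on std_triangle (K_pt \<tau>)"
  unfolding continuous_openin_preimage_eq
proof (intro allI impI)
  fix V :: "K set" assume "\<tau> \<in> K_triangles" "open V"
  moreover have "std_triangle \<inter> K_pt \<tau> -` V = {z \<in> std_triangle. K_pt \<tau> z \<in> V}" by auto
  ultimately show "openin (top_of_set std_triangle) (std_triangle \<inter> K_pt \<tau> -` V)"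
    by (simp add: open_K_def)
qed

definition triangle_lift :: "'c::topological_space set \<Rightarrow> ('c \<Rightarrow> K) \<Rightarrow> triangle \<Rightarrow> (complex \<Rightarrow> 'c) \<Rightarrow> bool" where
  "triangle_lift X1 pr \<tau> A \<longleftrightarrow> continuous_on std_triangle A \<and> A ` std_triangle \<subseteq> X1 \<and>
     (\<forall>z\<in>std_triangle. pr (A z) = K_pt \<tau> z)"

lemma std_triangle_subset_square: "z \<in> std_triangle \<Longrightarrow> Re z \<in> {0..1} \<and> Im z \<in> {0..1}"
proof -
  have conv: "convex {z. Re z \<in> {0..1} \<and> Im z \<in> {0..1}}"
  proof -
    have "{z. Re z \<in> {0..1} \<and> Im z \<in> {0..1}} = cbox 0 (Complex 1 1)"
      by (auto simp: in_cbox_complex_iff)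
    then show ?thesis by (simp only: convex_box)
  qed
  have "sqrt 3 \<le> 2" using real_le_lsqrt[of 2 3] by simp
  then have "std_triangle \<subseteq> {z. Re z \<in> {0..1} \<and> Im z \<in> {0..1}}"
    unfolding std_triangle_def by (intro hull_minimal conv) (auto simp: cos_60 sin_60)
  then show "z \<in> std_triangle \<Longrightarrow> Re z \<in> {0..1} \<and> Im z \<in> {0..1}" by blast
qed

lemma triangle_lift_exists:
  assumes cov: "covering_space X1 pr UNIV" and \<tau>: "\<tau> \<in> K_triangles" and x: "x \<in> X1" "pr x = K_vertex"
  obtains A where "triangle_lift X1 pr \<tau> A" "A 0 = x"
proof -
  have closed: "closed std_triangle" "convex std_triangle"
    unfolding std_triangle_def by (simp_all add: finite_imp_compact_convex_hull compact_imp_closed)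
  \<comment> \<open>The nearest-point projection extends the map of the triangle to the whole plane.
    The extension is lifted over the unit square, which contains the triangle, and the lift is then
    restricted.\<close>
  define f where "f = (\<lambda>u :: real \<times> real. K_pt \<tau> (closest_point std_triangle (Complex (fst u) (snd u))))"
  have "continuous_on UNIV f"
    unfolding f_def
  proof (rule continuous_on_compose2[OF continuous_on_K_pt[OF \<tau>]])
    show "continuous_on UNIV (\<lambda>u :: real \<times> real. closest_point std_triangle (Complex (fst u) (snd u)))"
      by (rule continuous_on_compose2[OF continuous_on_closest_point[OF closed(2,1)], where t = UNIV])
        (use zero_in_std_triangle in \<open>auto intro!: continuous_intros simp: Complex_eq\<close>)
    show "(\<lambda>u :: real \<times> real. closest_point std_triangle (Complex (fst u) (snd u))) ` UNIV \<subseteq> std_triangle"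
      using closest_point_in_set[OF closed(1)] zero_in_std_triangle by auto
  qed
  then have "lifts_on X1 pr f ({0..1} \<times> {0..1})"
    by (rule lifts_on_rectangle[OF cov]) auto
  moreover have "f (0, 0) = pr x"
    using x \<tau> zero_in_std_triangle by (simp add: f_def Complex_eq closest_point_self K_single_vertex)
  ultimately obtain g where g: "continuous_on ({0..1} \<times> {0..1}) g" "g ` ({0..1} \<times> {0..1}) \<subseteq> X1"
    "\<And>w. w \<in> {0..1} \<times> {0..1} \<Longrightarrow> pr (g w) = f w" "g (0, 0) = x"
    unfolding lifts_on_def using x(1) by (metis (no_types, lifting) SigmaI atLeastAtMost_iff order_refl zero_le_one)
  show thesis
  proof (rule that)
    have sub: "(\<lambda>z. (Re z, Im z)) ` std_triangle \<subseteq> {0..1} \<times> {0..1}"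
      using std_triangle_subset_square by auto
    have "continuous_on std_triangle (\<lambda>z. g (Re z, Im z))"
      by (rule continuous_on_compose2[OF g(1) _ sub]) (intro continuous_intros)
    moreover have "(\<lambda>z. g (Re z, Im z)) ` std_triangle \<subseteq> X1" using sub g(2) by blast
    moreover have "pr (g (Re z, Im z)) = K_pt \<tau> z" if "z \<in> std_triangle" for z
      using g(3)[of "(Re z, Im z)"] sub that by (auto simp: f_def closest_point_self)
    ultimately show "triangle_lift X1 pr \<tau> (\<lambda>z. g (Re z, Im z))" by (simp add: triangle_lift_def)
    show "g (Re 0, Im 0) = x" using g(4) by simp
  qed
qed

lemma triangle_lift_deck:
  assumes "is_lift X1 pr id h" "triangle_lift X1 pr \<tau> A"
  shows "triangle_lift X1 pr \<tau> (\<lambda>z. h (A z))"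
proof -
  obtain k where h: "homeomorphism X1 X1 h k" and pr: "\<And>x. x \<in> X1 \<Longrightarrow> pr (h x) = pr x"
    using assms(1) by (auto simp: is_lift_def)
  have A: "continuous_on std_triangle A" "A ` std_triangle \<subseteq> X1" "\<And>z. z \<in> std_triangle \<Longrightarrow> pr (A z) = K_pt \<tau> z"
    using assms(2) by (auto simp: triangle_lift_def)
  have "continuous_on std_triangle (\<lambda>z. h (A z))"
    by (rule continuous_on_compose2[of X1 h]) (use h A in \<open>auto simp: homeomorphism_def\<close>)
  moreover have "h (A z) \<in> X1" if "z \<in> std_triangle" for z
    using homeomorphism_image1[OF h] A(2) that by blast
  ultimately show ?thesis
    using A pr by (auto simp: triangle_lift_def)
qed

text \<open>Both curves lift the same loop from the same point. This is how a side of one lifted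
  triangle is recognised as a side of another.\<close>

lemma triangle_lift_side:
  assumes cov: "covering_space X1 pr UNIV" and A: "triangle_lift X1 pr \<tau> A" and \<tau>: "\<tau> \<in> K_triangles" "(l, g) \<in> sides \<tau>"
    and c: "continuous_on {0..1} c" "c ` {0..1} \<subseteq> X1" "\<And>s. s \<in> {0..1} \<Longrightarrow> pr (c s) = K_loop l s"
    and start: "c 0 = A (g 0)" and s: "s \<in> {0..1}"
  shows "c s = A (g s)"
proof (rule covering_lift_unique[OF cov, of "{0..1}" c "\<lambda>s. A (g s)" 0])
  have g: "continuous_on {0..1} g"
    using \<tau>(2) by (cases \<tau>) (auto intro: continuous_intros)
  have mem: "g s \<in> std_triangle" if "s \<in> {0..1}" for s
    using side_in_std_triangle[OF \<tau>(2)] that by blast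
  show "continuous_on {0..1} (\<lambda>s. A (g s))"
    by (rule continuous_on_compose2[of std_triangle A]) (use A g mem in \<open>auto simp: triangle_lift_def\<close>)
  show "(\<lambda>s. A (g s)) ` {0..1} \<subseteq> X1" using A mem by (auto simp: triangle_lift_def)
  show "pr (c s) = pr (A (g s))" if "s \<in> {0..1}" for s
  proof -
    have "pr (A (g s)) = K_pt \<tau> (g s)" using A mem[OF that] unfolding triangle_lift_def by blast
    then show ?thesis using c(3)[OF that] K_loop_eq[OF \<tau> that] by simp
  qed
  show "c 0 = A (g 0)" by (rule start)
qed (use c(1,2) s in simp_all)

section \<open>Lengths of lifted curves and of their images\<close>

lemma path_length_le:
  assumes "\<And>x y. 0 \<le> x \<Longrightarrow> x \<le> y \<Longrightarrow> y \<le> 1 \<Longrightarrow> d (c x) (c y) \<le> L * (y - x)" "0 \<le> L"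
  shows "path_length d c \<le> ereal L"
  unfolding path_length_def
proof (rule Sup_least, clarify)
  fix n :: nat and t :: "nat \<Rightarrow> real" assume t: "\<forall>i\<le>n. t i \<in> {0..1}" "\<forall>i<n. t i \<le> t (Suc i)"
  have "(\<Sum>i<n. d (c (t i)) (c (t (Suc i)))) \<le> (\<Sum>i<n. L * (t (Suc i) - t i))"
    using t by (intro sum_mono assms(1)) auto
  also have "\<dots> = L * (t n - t 0)" by (simp add: sum_distrib_left[symmetric] sum_lessThan_telescope)
  also have "\<dots> \<le> L * 1"
    using t(1)[rule_format, of n] t(1)[rule_format, of 0] assms(2) by (intro mult_left_mono) auto
  finally show "ereal (\<Sum>i<n. d (c (t i)) (c (t (Suc i)))) \<le> ereal L" by simp
qed

lemma path_length_ge: "ereal (d (c 0) (c 1)) \<le> path_length d c"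
  unfolding path_length_def
  by (rule Sup_upper, rule CollectI, rule exI[of _ 1], rule exI[of _ real]) auto

text \<open>The upper bound is witnessed by \<open>c\<close> itself; the lower one holds because a
  path is at least as long as the distance in \<open>K\<close> of its projected end points. Together
  they make the infimum finite, so that \<open>real_of_ereal\<close> does not return its default
  value 0.\<close>

lemma X1_dist_le:
  assumes "a \<le> b" and c: "continuous_on {a..b} c" "c ` {a..b} \<subseteq> X1"
    and short: "\<And>s t. a \<le> s \<Longrightarrow> s \<le> t \<Longrightarrow> t \<le> b \<Longrightarrow> K_dist (pr (c s)) (pr (c t)) \<le> t - s"
  shows "X1_dist X1 pr (c a) (c b) \<le> b - a" "K_dist (pr (c a)) (pr (c b)) \<le> X1_dist X1 pr (c a) (c b)"
proof -
  define S where "S = {path_length K_dist (pr \<circ> c') | c'.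
     path c' \<and> path_image c' \<subseteq> X1 \<and> pathstart c' = c a \<and> pathfinish c' = c b}"
  define c' where "c' = (\<lambda>s. c (a + s * (b - a)))"
  have mem: "a + s * (b - a) \<in> {a..b}" if "s \<in> {0..1}" for s
    using that \<open>a \<le> b\<close> mult_left_le_one_le[of "b - a" s] by auto
  have "path c'"
    unfolding path_def c'_def
    by (rule continuous_on_compose2[OF c(1)]) (use mem in \<open>auto intro!: continuous_intros\<close>)
  moreover have "path_image c' \<subseteq> X1" "pathstart c' = c a" "pathfinish c' = c b"
    using c(2) mem by (auto simp: path_image_def c'_def pathstart_def pathfinish_def)
  moreover have "path_length K_dist (pr \<circ> c') \<le> ereal (b - a)"
  proof (rule path_length_le)
    fix s t :: real assume st: "0 \<le> s" "s \<le> t" "t \<le> 1"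
    have "a + s * (b - a) \<le> a + t * (b - a)" using st \<open>a \<le> b\<close> by (simp add: mult_right_mono)
    then show "K_dist ((pr \<circ> c') s) ((pr \<circ> c') t) \<le> (b - a) * (t - s)"
      using short[of "a + s * (b - a)" "a + t * (b - a)"] mem[of s] mem[of t] st
      by (simp add: c'_def algebra_simps)
  qed (use \<open>a \<le> b\<close> in simp)
  ultimately have le: "Inf S \<le> ereal (b - a)"
    unfolding S_def by (intro Inf_lower2[of "path_length K_dist (pr \<circ> c')"]) blast+
  have ge: "ereal (K_dist (pr (c a)) (pr (c b))) \<le> Inf S"
    unfolding S_def
  proof (rule Inf_greatest, clarify)
    fix k assume "pathstart k = c a" "pathfinish k = c b"
    then show "ereal (K_dist (pr (c a)) (pr (c b))) \<le> path_length K_dist (pr \<circ> k)"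
      using path_length_ge[of K_dist "pr \<circ> k"] by (simp add: pathstart_def pathfinish_def)
  qed
  have "X1_dist X1 pr (c a) (c b) = real_of_ereal (Inf S)" by (simp add: X1_dist_def S_def)
  moreover obtain m where "Inf S = ereal m" using le ge by (cases "Inf S") auto
  ultimately show "X1_dist X1 pr (c a) (c b) \<le> b - a" "K_dist (pr (c a)) (pr (c b)) \<le> X1_dist X1 pr (c a) (c b)"
    using le ge by simp_all
qed

text \<open>\<open>N\<close> is open only relative to \<open>U\<close>, and the curve is allowed to
  leave \<open>U\<close>; hence the proviso on \<open>\<delta> t\<close>.\<close>

lemma curve_in_neighbourhood:
  fixes \<delta> :: "real \<Rightarrow> 'c::topological_space"
  assumes "openin (top_of_set U) N" "continuous_on I \<delta>" "t0 \<in> I" "\<delta> t0 \<in> N"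
  obtains \<eta> where "\<eta> > 0" "\<And>t. t \<in> I \<Longrightarrow> \<bar>t - t0\<bar> < \<eta> \<Longrightarrow> \<delta> t \<in> U \<Longrightarrow> \<delta> t \<in> N"
proof -
  obtain V where V: "open V" "N = U \<inter> V" using assms(1) by (auto simp: openin_open)
  obtain W where W: "open W" "I \<inter> \<delta> -` V = I \<inter> W"
    using continuous_openin_preimage_gen[OF assms(2) V(1)] unfolding openin_open by blast
  have "t0 \<in> I \<inter> \<delta> -` V" using assms(3,4) V(2) by simp
  then have "t0 \<in> W" unfolding W(2) by simp
  then obtain \<eta> where "\<eta> > 0" "\<And>t. dist t t0 < \<eta> \<Longrightarrow> t \<in> W"
    using W(1) unfolding open_dist by blast
  then have "\<delta> t \<in> V" if "t \<in> I" "\<bar>t - t0\<bar> < \<eta>" for t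
    using W(2) that by (auto simp: dist_real_def)
  then show thesis using that[OF \<open>\<eta> > 0\<close>] V(2) by blast
qed

text \<open>For short pieces of the curve, \<open>X1_dist\<close> of the end points equals the
  elapsed time: the piece itself bounds it from above, its projection to \<open>K\<close> from
  below. The scaling property of \<open>f\<close> then yields the speed \<open>r\<close>.\<close>

lemma crossing_const_speed:
  assumes cross: "crossing l \<sigma> \<tau> e z w"
    and \<delta>: "continuous_on {-1/2..1/2} \<delta>" "\<delta> ` {-1/2..1/2} \<subseteq> X1"
      "\<And>t. t \<in> {-1/2..1/2} \<Longrightarrow> pr (\<delta> t) = crossing_pt \<sigma> \<tau> z w t"
    and f: "\<And>x. x \<in> X1 - X1_vertices X1 pr \<Longrightarrow> \<exists>N. openin (top_of_set (X1 - X1_vertices X1 pr)) N \<and> x \<in> N \<and>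
        (\<forall>p\<in>N. \<forall>q\<in>N. d (f p) (f q) = r * X1_dist X1 pr p q)"
    and sym: "\<And>x y. d x y = d y x" and t0: "t0 \<in> {-1/4..1/4}"
  shows "\<exists>\<eta>>0. const_speed_on d r (\<lambda>t. f (\<delta> t)) {t0 - \<eta><..<t0 + \<eta>}"
proof -
  let ?U = "X1 - X1_vertices X1 pr"
  have U: "\<delta> t \<in> ?U" if "\<bar>t\<bar> < 1/2" for t
  proof -
    have "t \<in> {-1/2..1/2}" using that by auto
    then show ?thesis using \<delta>(2,3) crossing_pt_neq_vertex[OF cross that] by (auto simp: X1_vertices_def)
  qed
  have t0': "\<bar>t0\<bar> \<le> 1/4" unfolding abs_le_iff using t0 by auto
  then have t0I: "t0 \<in> {-1/2..1/2}" by auto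
  obtain N where N: "openin (top_of_set ?U) N" "\<delta> t0 \<in> N"
    "\<And>p q. p \<in> N \<Longrightarrow> q \<in> N \<Longrightarrow> d (f p) (f q) = r * X1_dist X1 pr p q"
    using f[OF U[of t0]] t0' by auto
  obtain \<eta> where \<eta>: "\<eta> > 0" "\<And>t. t \<in> {-1/2..1/2} \<Longrightarrow> \<bar>t - t0\<bar> < \<eta> \<Longrightarrow> \<delta> t \<in> ?U \<Longrightarrow> \<delta> t \<in> N"
    using curve_in_neighbourhood[OF N(1) \<delta>(1) t0I N(2)] by metis
  define \<eta>' where "\<eta>' = min \<eta> (1/20)"
  have \<eta>': "\<eta>' \<le> \<eta>" "\<eta>' \<le> 1/20" "\<eta>' > 0" using \<eta>(1) by (auto simp: \<eta>'_def)
  have key: "d (f (\<delta> s)) (f (\<delta> t)) = r * (t - s)" if "t0 - \<eta>' < s" "s \<le> t" "t < t0 + \<eta>'" for s t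
  proof -
    have st: "\<bar>s - t0\<bar> < \<eta>" "\<bar>t - t0\<bar> < \<eta>" "\<bar>s\<bar> < 1/2" "\<bar>t\<bar> < 1/2" "t0 - 1/20 \<le> s" "t \<le> t0 + 1/20"
      using that t0' \<eta>' by linarith+
    have I: "s \<in> {-1/2..1/2}" "t \<in> {-1/2..1/2}" using st(3,4) by auto
    have sub: "{s..t} \<subseteq> {-1/2..1/2}" using I by auto
    have short: "K_dist (pr (\<delta> x)) (pr (\<delta> y)) \<le> y - x" if "s \<le> x" "x \<le> y" "y \<le> t" for x y
    proof -
      have "x \<in> {-1/2..1/2}" "y \<in> {-1/2..1/2}" using sub that by auto
      then show ?thesis using crossing_K_dist_le[OF cross _ \<open>x \<le> y\<close>] \<delta>(3) by simp
    qed
    have im: "\<delta> ` {s..t} \<subseteq> X1" using image_mono[OF sub] \<delta>(2) by (rule order_trans)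
    note X1_dist_le[OF \<open>s \<le> t\<close> continuous_on_subset[OF \<delta>(1) sub] im short]
    moreover have "t - s \<le> K_dist (pr (\<delta> s)) (pr (\<delta> t))"
      using crossing_K_dist_ge[OF cross t0 st(5) \<open>s \<le> t\<close> st(6)] \<delta>(3) I by simp
    ultimately have "X1_dist X1 pr (\<delta> s) (\<delta> t) = t - s" by linarith
    then show ?thesis
      using N(3)[OF \<eta>(2)[OF I(1) st(1) U[OF st(3)]] \<eta>(2)[OF I(2) st(2) U[OF st(4)]]] by simp
  qed
  have "const_speed_on d r (\<lambda>t. f (\<delta> t)) {t0 - \<eta>'<..<t0 + \<eta>'}"
    unfolding const_speed_on_def
  proof (intro ballI)
    fix s t assume "s \<in> {t0 - \<eta>'<..<t0 + \<eta>'}" "t \<in> {t0 - \<eta>'<..<t0 + \<eta>'}"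
    then show "d (f (\<delta> s)) (f (\<delta> t)) = r * \<bar>s - t\<bar>"
      using key[of s t] key[of t s] sym[of "f (\<delta> s)" "f (\<delta> t)"] by (cases "s \<le> t") simp_all
  qed
  then show ?thesis using \<eta>'(3) by blast
qed

lemma crossing_lifts_const_speed:
  assumes cross: "crossing l \<sigma> \<tau> e z w" and zw: "continuous_on UNIV z" "continuous_on UNIV w"
    and A: "triangle_lift X1 pr \<sigma> A" and B: "triangle_lift X1 pr \<tau> B" and AB: "A (z 0) = B (w 0)"
    and f: "\<And>x. x \<in> X1 - X1_vertices X1 pr \<Longrightarrow> \<exists>N. openin (top_of_set (X1 - X1_vertices X1 pr)) N \<and> x \<in> N \<and>
        (\<forall>p\<in>N. \<forall>q\<in>N. d (f p) (f q) = r * X1_dist X1 pr p q)"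
    and sym: "\<And>x y. d x y = d y x" and t0: "t0 \<in> {-1/4..1/4}"
  shows "\<exists>\<eta>>0. const_speed_on d r (\<lambda>t. f (if t \<le> 0 then A (z t) else B (w t))) {t0 - \<eta><..<t0 + \<eta>}"
proof (rule crossing_const_speed[OF cross, where \<delta> = "\<lambda>t. if t \<le> 0 then A (z t) else B (w t)" and f = f and d = d
      and ?X1.0 = X1 and pr = pr])
  have z: "z t \<in> std_triangle" if "t \<in> {-1/2..0}" for t using cross that unfolding crossing_def by blast
  have w: "w t \<in> std_triangle" if "t \<in> {0..1/2}" for t using cross that unfolding crossing_def by blast
  have "continuous_on {-1/2..0} (\<lambda>t. A (z t))"
    by (rule continuous_on_compose2[OF _ continuous_on_subset[OF zw(1)]]) (use A z in \<open>auto simp: triangle_lift_def\<close>)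
  moreover have "continuous_on {0..1/2} (\<lambda>t. B (w t))"
    by (rule continuous_on_compose2[OF _ continuous_on_subset[OF zw(2)]]) (use B w in \<open>auto simp: triangle_lift_def\<close>)
  ultimately have "continuous_on ({-1/2..0} \<union> {0..1/2}) (\<lambda>t. if t \<le> 0 then A (z t) else B (w t))"
    by (rule continuous_on_cases[rotated 2]) (use AB in auto)
  moreover have "{-1/2..0} \<union> {0..1/2} = {-1/2..1/2 :: real}" by auto
  ultimately show "continuous_on {-1/2..1/2} (\<lambda>t. if t \<le> 0 then A (z t) else B (w t))" by simp
  show "(\<lambda>t. if t \<le> 0 then A (z t) else B (w t)) ` {-1/2..1/2} \<subseteq> X1"
    using A B z w by (auto simp: triangle_lift_def)
  show "pr (if t \<le> 0 then A (z t) else B (w t)) = crossing_pt \<sigma> \<tau> z w t" if "t \<in> {-1/2..1/2}" for t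
    using A B z[of t] w[of t] that by (auto simp: triangle_lift_def crossing_pt_def)
qed (use f sym t0 in auto)

text \<open>On the open edge the scaling property makes \<open>f\<close> locally
  \<open>r\<close>-Lipschitz, hence \<open>r\<close>-Lipschitz. The ends are vertices, where the
  scaling property is silent; continuity of \<open>f\<close> reaches them at a cost of
  \<open>\<epsilon>\<close> each.\<close>

lemma edge_displacement:
  assumes "Metric_space X d" and \<tau>: "(u, v, w) \<in> K_triangles" and A: "triangle_lift X1 pr (u, v, w) A"
    and f: "\<And>x. x \<in> X1 - X1_vertices X1 pr \<Longrightarrow> \<exists>N. openin (top_of_set (X1 - X1_vertices X1 pr)) N \<and> x \<in> N \<and>
        (\<forall>p\<in>N. \<forall>q\<in>N. d (f p) (f q) = r * X1_dist X1 pr p q)"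
    and cont: "continuous_map (top_of_set X1) (Metric_space.mtopology X d) f" and r: "r > 0"
  shows "d (f (A 0)) (f (A (cis (pi / 3)))) \<le> r"
proof -
  interpret Metric_space X d by fact
  define L where "L s = A (of_real s * cis (pi / 3))" for s :: real
  have mem: "of_real s * cis (pi / 3) \<in> std_triangle" if "s \<in> {0..1}" for s
    using std_triangle_mem[of 0 s] that by simp
  have L: "continuous_on {0..1} L"
    unfolding L_def by (rule continuous_on_compose2[of std_triangle A])
      (use A mem in \<open>auto simp: triangle_lift_def intro!: continuous_intros\<close>)
  have LX: "L s \<in> X1" "pr (L s) = K_pt (u, v, w) (of_real s * cis (pi / 3))" if "s \<in> {0..1}" for s
    using A mem[OF that] by (auto simp: triangle_lift_def L_def)
  have fX: "f x \<in> X" if "x \<in> X1" for x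
    using continuous_map_image_subset_topspace[OF cont] that by auto
  have LU: "L s \<in> X1 - X1_vertices X1 pr" if "0 < s" "s < 1" for s
  proof -
    have "of_real s * cis (pi / 3) \<notin> {0, 1, cis (pi / 3)}"
      using that by (simp add: complex_eq_iff cos_60 sin_60)
    then show ?thesis
      using LX[of s] K_pt_eq_vertex[OF \<tau> mem[of s]] that by (auto simp: X1_vertices_def)
  qed
  have short: "K_dist (pr (L s)) (pr (L t)) \<le> t - s" if "0 \<le> s" "s \<le> t" "t \<le> 1" for s t
  proof -
    have "complex_of_real s * cis (pi / 3) - of_real t * cis (pi / 3) = of_real (s - t) * cis (pi / 3)"
      by (simp add: left_diff_distrib)
    then have "dist (complex_of_real s * cis (pi / 3)) (of_real t * cis (pi / 3)) = t - s"
      using that by (simp only: dist_norm norm_mult norm_of_real norm_cis) simp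
    then show ?thesis
      using K_dist_le[OF K_string_triangle[OF \<tau> mem[of s] mem[of t]]] LX(2)[of s] LX(2)[of t] that by simp
  qed
  have interior: "d (f (L a)) (f (L b)) \<le> r * (b - a)" if ab: "0 < a" "a \<le> b" "b < 1" for a b
  proof (rule local_Lipschitz_imp_Lipschitz[OF \<open>Metric_space X d\<close>, of "\<lambda>s. f (L s)"])
    show "(\<lambda>s. f (L s)) ` {a..b} \<subseteq> X" using ab fX LX(1) by auto
    fix t assume t: "t \<in> {a..b}"
    then have t01: "0 < t" "t < 1" "t \<in> {0..1}" using ab by auto
    obtain N where N: "openin (top_of_set (X1 - X1_vertices X1 pr)) N" "L t \<in> N"
      "\<And>p q. p \<in> N \<Longrightarrow> q \<in> N \<Longrightarrow> d (f p) (f q) = r * X1_dist X1 pr p q"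
      using f[OF LU[OF t01(1,2)]] by blast
    obtain \<eta> where \<eta>: "\<eta> > 0" "\<And>s. s \<in> {0..1} \<Longrightarrow> \<bar>s - t\<bar> < \<eta> \<Longrightarrow> L s \<in> X1 - X1_vertices X1 pr \<Longrightarrow> L s \<in> N"
      using curve_in_neighbourhood[OF N(1) L t01(3) N(2)] by metis
    have "d (f (L x)) (f (L y)) \<le> r * (y - x)"
      if xy: "t - min \<eta> (min t (1 - t)) < x" "x \<le> y" "y < t + min \<eta> (min t (1 - t))" for x y
    proof -
      have "t - \<eta> < x" "0 < x" "y < t + \<eta>" "y < 1" using xy by simp_all
      then have b: "0 < x" "x < 1" "0 < y" "y < 1" "\<bar>x - t\<bar> < \<eta>" "\<bar>y - t\<bar> < \<eta>" using xy(2) by auto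
      then have "L x \<in> N" "L y \<in> N" using \<eta>(2) LU by auto
      moreover have "X1_dist X1 pr (L x) (L y) \<le> y - x"
      proof (rule X1_dist_le(1)[OF xy(2)])
        show "continuous_on {x..y} L" by (rule continuous_on_subset[OF L]) (use b in auto)
        show "L ` {x..y} \<subseteq> X1" using LX(1) b by auto
      qed (use short b in auto)
      ultimately show ?thesis using N(3) r by (simp add: mult_left_mono)
    qed
    then show "\<exists>\<eta>>0. \<forall>x y. t - \<eta> < x \<and> x \<le> y \<and> y < t + \<eta> \<longrightarrow> d (f (L x)) (f (L y)) \<le> r * (y - x)"
      using \<eta>(1) t01 by (intro exI[of _ "min \<eta> (min t (1 - t))"]) auto
  qed (use ab in simp)
  have close: "\<exists>\<eta>>0. \<forall>s\<in>{0..1}. \<bar>s - t\<bar> < \<eta> \<longrightarrow> d (f (L t)) (f (L s)) < \<epsilon>" if t: "t \<in> {0..1}" and \<epsilon>: "\<epsilon> > 0" for t \<epsilon>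
  proof -
    define S where "S = {x \<in> X1. f x \<in> mball (f (L t)) \<epsilon>}"
    have "openin (top_of_set X1) S"
      using openin_continuous_map_preimage[OF cont openin_mball] by (simp add: S_def)
    moreover have "L t \<in> S"
      using LX(1)[OF t] fX \<epsilon> by (simp add: S_def in_mball)
    ultimately obtain \<eta> where "\<eta> > 0" and \<eta>: "\<And>s. s \<in> {0..1} \<Longrightarrow> \<bar>s - t\<bar> < \<eta> \<Longrightarrow> L s \<in> X1 \<Longrightarrow> L s \<in> S"
      using curve_in_neighbourhood[OF _ L t] by metis
    have "d (f (L t)) (f (L s)) < \<epsilon>" if "s \<in> {0..1}" "\<bar>s - t\<bar> < \<eta>" for s
      using \<eta>[OF that LX(1)[OF that(1)]] by (simp add: S_def in_mball)
    then show ?thesis using \<open>\<eta> > 0\<close> by (intro exI[of _ \<eta>] conjI ballI impI)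
  qed
  have "d (f (L 0)) (f (L 1)) \<le> r + 2 * \<epsilon>" if "\<epsilon> > 0" for \<epsilon>
  proof -
    have "(0::real) \<in> {0..1}" "(1::real) \<in> {0..1}" by simp_all
    note c = close[OF this(1) \<open>\<epsilon> > 0\<close>] close[OF this(2) \<open>\<epsilon> > 0\<close>]
    obtain \<eta> where \<eta>: "\<eta> > 0" "\<forall>s\<in>{0..1}. \<bar>s - 0\<bar> < \<eta> \<longrightarrow> d (f (L 0)) (f (L s)) < \<epsilon>"
      using c(1) by (elim exE conjE)
    obtain \<theta> where \<theta>: "\<theta> > 0" "\<forall>s\<in>{0..1}. \<bar>s - 1\<bar> < \<theta> \<longrightarrow> d (f (L 1)) (f (L s)) < \<epsilon>"
      using c(2) by (elim exE conjE)
    define a where "a = min (1/2) (\<eta> / 2)"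
    define b where "b = 1 - min (1/2) (\<theta> / 2)"
    have ab: "0 < a" "a < \<eta>" "a \<le> b" "b < 1" "1 - b < \<theta>" "a \<le> 1/2" "1/2 \<le> b"
      using \<eta>(1) \<theta>(1) by (simp_all add: a_def b_def min_def)
    have 1: "d (f (L 0)) (f (L a)) < \<epsilon>" using ab by (intro \<eta>(2)[rule_format]) auto
    have 2: "d (f (L 1)) (f (L b)) < \<epsilon>" using ab by (intro \<theta>(2)[rule_format]) auto
    have "r * (b - a) \<le> r" using ab r by (intro mult_left_le) auto
    then have 3: "d (f (L a)) (f (L b)) \<le> r" using interior[OF ab(1,3,4)] by linarith
    have X: "f (L 0) \<in> X" "f (L a) \<in> X" "f (L b) \<in> X" "f (L 1) \<in> X"
      using fX[OF LX(1)] ab by simp_all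
    show ?thesis
      using 1 2 3 triangle[OF X(1,2,4)] triangle[OF X(2,3,4)] commute[of "f (L 1)" "f (L b)"] by linarith
  qed
  note * = this
  have "d (f (L 0)) (f (L 1)) \<le> r"
  proof (rule field_le_epsilon)
    show "d (f (L 0)) (f (L 1)) \<le> r + \<epsilon>" if "\<epsilon> > 0" for \<epsilon>
      using *[of "\<epsilon> / 2"] that by simp
  qed
  then show ?thesis by (simp add: L_def)
qed

lemma funpow_displacement_le:
  assumes "Metric_space X d" and h: "h ` X \<subseteq> X" "\<And>x y. x \<in> X \<Longrightarrow> y \<in> X \<Longrightarrow> d (h x) (h y) = d x y" and x: "x \<in> X"
  shows "d x ((h ^^ n) x) \<le> n * d x (h x)"
proof (induction n)
  case 0
  then show ?case using Metric_space.zero[OF assms(1) x x] by simp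
next
  case (Suc n)
  interpret Metric_space X d by fact
  have hn: "(h ^^ m) x \<in> X" for m by (induction m) (use h(1) x in auto)
  have "d x ((h ^^ Suc n) x) \<le> d x (h x) + d (h x) ((h ^^ Suc n) x)"
    by (rule triangle) (use x hn[of 1] hn[of "Suc n"] in auto)
  also have "d (h x) ((h ^^ Suc n) x) = d x ((h ^^ n) x)" using h(2) x hn by simp
  finally show ?case using Suc by (simp add: algebra_simps)
qed

section \<open>The theorem\<close>

theorem theorem1p4:
  fixes X1 :: "'c::topological_space set"
    and pr :: "'c \<Rightarrow> K"
    and v :: 'c
    and \<rho> :: "braid_gen word set set \<Rightarrow> 'c \<Rightarrow> 'c"
  assumes "universal_cover X1 pr"
    and "v \<in> X1" and "pr v = K_vertex"
    and "G1_action_on_X1 X1 pr v \<rho>"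
  shows "\<not> (\<exists>(X :: 'x set) (d :: 'x \<Rightarrow> 'x \<Rightarrow> real)
               (\<phi> :: braid_gen word set set \<Rightarrow> 'x \<Rightarrow> 'x) (f1 :: 'c \<Rightarrow> 'x).
            CAT0 X d \<and> has_covering_dim (Metric_space.mtopology X d) 2 \<and>
            isometric_action G0 X d \<phi> \<and> proper_action G0 X d \<phi> \<and>
            (\<forall>g\<in>carrier G0. semisimple_isometry X d (\<phi> g)) \<and>
            geometric_action G1 X d \<phi> \<and>
            continuous_map (top_of_set X1) (Metric_space.mtopology X d) f1 \<and>
            equivariant_map G1 X1 \<rho> \<phi> f1 \<and>
            locally_injective X1 f1 \<and>
            locally_isometric_up_to_scaling (X1 - X1_vertices X1 pr) (X1_dist X1 pr) d f1)"
proof (rule notI, elim exE conjE)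
  fix X :: "'x set" and d \<phi> and f :: "'c \<Rightarrow> 'x"
  assume cat: "CAT0 X d" and iso: "isometric_action G0 X d \<phi>"
    and cont: "continuous_map (top_of_set X1) (Metric_space.mtopology X d) f"
    and equi: "equivariant_map G1 X1 \<rho> \<phi> f"
    and "locally_isometric_up_to_scaling (X1 - X1_vertices X1 pr) (X1_dist X1 pr) d f"
  then obtain r where r: "r > 0" and loc: "\<And>x. x \<in> X1 - X1_vertices X1 pr \<Longrightarrow>
      \<exists>N. openin (top_of_set (X1 - X1_vertices X1 pr)) N \<and> x \<in> N \<and>
        (\<forall>p\<in>N. \<forall>q\<in>N. d (f p) (f q) = r * X1_dist X1 pr p q)"
    unfolding locally_isometric_up_to_scaling_def by blast
  interpret Metric_space X d using cat by (simp add: CAT0_def)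
  interpret act: group_action G0 X \<phi> using iso by (simp add: isometric_action_def)
  interpret G0: group G0 by (rule group_G0)
  have \<phi>d: "d (\<phi> g x) (\<phi> g y) = d x y" if "g \<in> carrier G0" "x \<in> X" "y \<in> X" for g x y
    using iso that by (simp add: isometric_action_def)
  have \<phi>X: "\<phi> g x \<in> X" if "g \<in> carrier G0" "x \<in> X" for g x
    using act.element_image[OF that] by blast
  have \<phi>m: "\<phi> (g \<otimes>\<^bsub>G0\<^esub> h) x = \<phi> g (\<phi> h x)" if "g \<in> carrier G0" "h \<in> carrier G0" "x \<in> X" for g h x
    using act.composition_rule that by blast
  have fX: "f x \<in> X" if "x \<in> X1" for x
    using continuous_map_image_subset_topspace[OF cont] that by auto
  define a e where "a = \<rho> G0_a" and "e = \<rho> G0_e"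
  have cov: "covering_space X1 pr UNIV" using assms(1) by (simp add: universal_cover_def)
  have a_loop: "deck_of_loop X1 pr v (K_loop La) a" and e_loop: "deck_of_loop X1 pr v (K_loop Le) e"
    and yv: "\<rho> G0_y v = v"
    using assms(4) by (simp_all add: G1_action_on_X1_def a_def e_def)
  then have a_lift: "is_lift X1 pr id a" and e_lift: "is_lift X1 pr id e"
    by (simp_all add: deck_of_loop_def)
  then have aX: "a x \<in> X1" and eX: "e x \<in> X1" if "x \<in> X1" for x
    using that homeomorphism_image1 by (metis imageI is_lift_def)+
  have fa: "f (a x) = \<phi> G0_a (f x)" and fe: "f (e x) = \<phi> G0_e (f x)" and fy: "f (\<rho> G0_y x) = \<phi> G0_y (f x)"
    if "x \<in> X1" for x
    using equi that G1_memb by (simp_all add: equivariant_map_def a_def e_def)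
  have tri: "(La, Le, Lt1) \<in> K_triangles" "(Le, Lb, Lt1) \<in> K_triangles"
    by (simp_all add: K_triangles_def Y_triangles_def)
  \<comment> \<open>The strip consists of the translates of \<open>T\<close> and \<open>D\<close> by
    powers of \<open>a\<close>. The corners of \<open>T\<close> are \<open>v\<close>,
    \<open>a v\<close> and \<open>a e v\<close>; \<open>D\<close> shares with \<open>T\<close> the
    \<open>t1\<close> edge at \<open>v\<close>, and \<open>a D\<close> shares with \<open>T\<close>
    the \<open>e\<close> edge from \<open>a v\<close> to \<open>a e v\<close>.\<close>
  obtain T where T: "triangle_lift X1 pr (La, Le, Lt1) T" "T 0 = v"
    using triangle_lift_exists[OF cov tri(1) assms(2,3)] .
  obtain D where D: "triangle_lift X1 pr (Le, Lb, Lt1) D" "D 0 = v"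
    using triangle_lift_exists[OF cov tri(2) assms(2,3)] .
  note aD = triangle_lift_deck[OF a_lift D(1)] and aT = triangle_lift_deck[OF a_lift T(1)]
  obtain ca where ca: "continuous_on {0..1} ca" "ca ` {0..1} \<subseteq> X1" "ca 0 = v" "ca 1 = a v"
    "\<And>s. s \<in> {0..1} \<Longrightarrow> pr (ca s) = K_loop La s"
    using a_loop by (auto simp: deck_of_loop_def path_def path_image_def pathstart_def pathfinish_def)
  obtain ce where ce: "continuous_on {0..1} ce" "ce ` {0..1} \<subseteq> X1" "ce 0 = v" "ce 1 = e v"
    "\<And>s. s \<in> {0..1} \<Longrightarrow> pr (ce s) = K_loop Le s"
    using e_loop by (auto simp: deck_of_loop_def path_def path_image_def pathstart_def pathfinish_def)
  have "ca 1 = T (linepath 0 1 1)"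
    by (rule triangle_lift_side[OF cov T(1) tri(1), of La]) (use ca T in \<open>auto simp: linepath_def\<close>)
  then have T1: "T 1 = a v" using ca(4) by (simp add: linepath_def)
  have De: "ce s = D (linepath 0 1 s)" if "s \<in> {0..1}" for s
    by (rule triangle_lift_side[OF cov D(1) tri(2), of Le]) (use ce D that in \<open>auto simp: linepath_def\<close>)
  have Te: "a (ce s) = T (linepath 1 (cis (pi / 3)) s)" if "s \<in> {0..1}" for s
  proof (rule triangle_lift_side[OF cov T(1) tri(1), of Le _ "\<lambda>s. a (ce s)"])
    obtain k where "homeomorphism X1 X1 a k" using a_lift by (auto simp: is_lift_def)
    then show "continuous_on {0..1} (\<lambda>s. a (ce s))"
      by (intro continuous_on_compose2[OF _ ce(1) ce(2)]) (simp add: homeomorphism_def)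
    show "(\<lambda>s. a (ce s)) ` {0..1} \<subseteq> X1" using ce(2) aX by auto
    show "pr (a (ce s)) = K_loop Le s" if "s \<in> {0..1}" for s
    proof -
      have "ce s \<in> X1" using ce(2) that by blast
      then show ?thesis using a_lift ce(5)[OF that] by (simp add: is_lift_def)
    qed
    show "a (ce 0) = T (linepath 1 (cis (pi / 3)) 0)" using ce(3) T1 by (simp add: linepath_def)
  qed (use that in auto)
  have T2: "T (cis (pi / 3)) = a (e v)" using Te[of 1] ce(4) by (simp add: linepath_def)
  have DT: "D (linepath 0 (cis (pi / 3)) s) = T (linepath 0 (cis (pi / 3)) s)" if "s \<in> {0..1}" for s
  proof (rule triangle_lift_side[OF cov T(1) tri(1), of Lt1 _ "\<lambda>s. D (linepath 0 (cis (pi / 3)) s)"])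
    have mem: "linepath 0 (cis (pi / 3)) s \<in> std_triangle" if "s \<in> {0..1}" for s
      by (rule side_in_std_triangle[of Lt1 _ "(La, Le, Lt1)"]) (use that in auto)
    show "continuous_on {0..1} (\<lambda>s. D (linepath 0 (cis (pi / 3)) s))"
      by (rule continuous_on_compose2[of std_triangle D])
        (use D mem in \<open>auto simp: triangle_lift_def intro: continuous_intros\<close>)
    show "(\<lambda>s. D (linepath 0 (cis (pi / 3)) s)) ` {0..1} \<subseteq> X1"
      using D mem by (auto simp: triangle_lift_def)
    show "pr (D (linepath 0 (cis (pi / 3)) s)) = K_loop Lt1 s" if "s \<in> {0..1}" for s
      using D(1) mem[OF that] K_loop_eq[OF tri(2), of Lt1 _ s] that by (auto simp: triangle_lift_def)
    show "D (linepath 0 (cis (pi / 3)) 0) = T (linepath 0 (cis (pi / 3)) 0)"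
      using D(2) T(2) by (simp add: linepath_def)
  qed (use that in auto)
  define zT where "zT = (\<lambda>t::real. of_real (1 / 2 + t) + of_real (1 / 2) * cis (pi / 3))"
  define wD where "wD = (\<lambda>t::real. of_real (1 / 2 - t) + of_real t * cis (pi / 3))"
  define zD where "zD = (\<lambda>t::real. of_real (- t) + of_real (1 / 2 + t) * cis (pi / 3))"
  define wT where "wT = (\<lambda>t::real. of_real t + of_real (1 / 2) * cis (pi / 3))"
  have cts: "continuous_on UNIV zT" "continuous_on UNIV wD" "continuous_on UNIV zD" "continuous_on UNIV wT"
    by (auto simp: zT_def wD_def zD_def wT_def intro!: continuous_intros)
  note cross_e = crossing_e[folded zT_def wD_def] and cross_t = crossing_t[folded zD_def wT_def]
  \<comment> \<open>One period of the image of the midline: through \<open>T\<close> from its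
    \<open>t1\<close> edge to its \<open>e\<close> edge, then through \<open>a D\<close> to the
    \<open>t1\<close> edge that is the \<open>a\<close>-image of the first one.\<close>
  define E where "E = (\<lambda>t. f (if t \<le> 0 then T (zT t) else a (D (wD t))))"
  have half: "linepath 0 (cis (pi / 3)) (1/2) = wT 0" "zD 0 = wT 0" "zT (-1/2) = wT 0" "wD (1/2) = wT 0"
    "linepath 1 (cis (pi / 3)) (1/2) = zT 0" "linepath 0 1 (1/2) = wD 0"
    by (simp_all add: zT_def wD_def zD_def wT_def linepath_def complex_eq_iff cos_60 sin_60)
  have mid_e: "T (zT 0) = a (D (wD 0))"
    using Te[of "1/2"] De[of "1/2"] unfolding half by simp
  have mid_t: "D (wT 0) = T (wT 0)"
    using DT[of "1/2"] unfolding half by simp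
  have E_local: "\<exists>\<eta>>0. const_speed_on d r E {t - \<eta><..<t + \<eta>}" if "t \<in> {-1/4..1/4}" for t
    unfolding E_def
    by (rule crossing_lifts_const_speed[OF cross_e cts(1,2) T(1) aD mid_e]) (use loc commute that in auto)
  \<comment> \<open>Where two periods meet, the midline passes from \<open>a D\<close> to
    \<open>a T\<close> through their common \<open>t1\<close> edge.\<close>
  have F_local: "\<exists>\<eta>>0. const_speed_on d r (\<lambda>t. if t \<le> 0 then E (t + 1/2) else \<phi> G0_a (E (t - 1/2))) {t - \<eta><..<t + \<eta>}"
    if t: "t \<in> {-1/4..1/4}" for t
  proof -
    have "\<exists>\<eta>>0. const_speed_on d r (\<lambda>t. f (if t \<le> 0 then a (D (zD t)) else a (T (wT t)))) {t - \<eta><..<t + \<eta>}"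
      by (rule crossing_lifts_const_speed[OF cross_t cts(3,4) aD aT]) (use loc commute t half mid_t in auto)
    then obtain \<eta> where \<eta>: "\<eta> > 0"
      "const_speed_on d r (\<lambda>t. f (if t \<le> 0 then a (D (zD t)) else a (T (wT t)))) {t - \<eta><..<t + \<eta>}" by blast
    have eq: "(if s \<le> 0 then E (s + 1/2) else \<phi> G0_a (E (s - 1/2))) = f (if s \<le> 0 then a (D (zD s)) else a (T (wT s)))"
      if "-1/2 < s" "s < 1/2" for s
    proof (cases "s \<le> 0")
      case True
      have "wD (s + 1/2) = zD s" by (simp add: wD_def zD_def algebra_simps)
      then show ?thesis using True that by (simp add: E_def)
    next
      case False
      have "zT (s - 1/2) = wT s" by (simp add: zT_def wT_def)
      moreover have "T (wT s) \<in> X1"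
        using T(1) cross_t False that by (auto simp: triangle_lift_def crossing_def)
      ultimately show ?thesis using False that by (simp add: E_def fa)
    qed
    have "const_speed_on d r (\<lambda>t. if t \<le> 0 then E (t + 1/2) else \<phi> G0_a (E (t - 1/2))) {t - min \<eta> (1/8)<..<t + min \<eta> (1/8)}"
      unfolding const_speed_on_def
    proof (intro ballI)
      fix x y assume xy: "x \<in> {t - min \<eta> (1/8)<..<t + min \<eta> (1/8)}" "y \<in> {t - min \<eta> (1/8)<..<t + min \<eta> (1/8)}"
      then have "-1/2 < x" "x < 1/2" "-1/2 < y" "y < 1/2" "x \<in> {t - \<eta><..<t + \<eta>}" "y \<in> {t - \<eta><..<t + \<eta>}"
        using t by auto
      then show "d (if x \<le> 0 then E (x + 1/2) else \<phi> G0_a (E (x - 1/2)))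
          (if y \<le> 0 then E (y + 1/2) else \<phi> G0_a (E (y - 1/2))) = r * \<bar>x - y\<bar>"
        using \<eta>(2) unfolding eq[OF \<open>-1/2 < x\<close> \<open>x < 1/2\<close>] eq[OF \<open>-1/2 < y\<close> \<open>y < 1/2\<close>] const_speed_on_def by blast
    qed
    then show ?thesis using \<eta>(1) by (intro exI[of _ "min \<eta> (1/8)"]) simp
  qed
  have memT: "T (zT t) \<in> X1" if "t \<in> {-1/2..0}" for t
    using T(1) cross_e that unfolding triangle_lift_def crossing_def by blast
  have memD: "a (D (wD t)) \<in> X1" if "t \<in> {0..1/2}" for t
    using aD cross_e that unfolding triangle_lift_def crossing_def by blast
  have EX: "E ` {-1/2..1/2} \<subseteq> X" using memT memD by (auto simp: E_def intro!: fX)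
  have E_shift: "E (1/2) = \<phi> G0_a (E (-1/2))"
    using fa[OF memT[of "-1/2"]] half mid_t by (simp add: E_def)
  define q where "q = E (-1/4)"
  have q: "q \<in> X" using EX by (auto simp: q_def)
  have axis: "d q ((\<phi> G0_a ^^ n) q) = r * n" for n
    unfolding q_def
    by (rule CAT0_axis[OF cat r _ _ EX E_shift E_local F_local]) (use \<phi>X \<phi>d in auto)
  define p where "p = f v"
  have p: "p \<in> X" using fX assms(2) by (simp add: p_def)
  \<comment> \<open>The third side of \<open>T\<close> joins \<open>v\<close> to
    \<open>a e v\<close>.\<close>
  have ae: "d p (\<phi> (G0_a \<otimes>\<^bsub>G0\<^esub> G0_e) p) \<le> r"
    using edge_displacement[OF Metric_space_axioms tri(1) T(1) loc cont r] T(2) T2 assms(2)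
    by (simp add: p_def \<phi>m G0_e_closed fa fe fX eX)
  have \<phi>y: "\<phi> G0_y p = p" using fy[OF assms(2)] yv by (simp add: p_def)
  let ?t = "G0_a \<otimes>\<^bsub>G0\<^esub> G0_e"
  have t: "?t \<in> carrier G0" by (simp add: G0_e_closed)
  have cc: "d p (\<phi> G0_c (\<phi> G0_c p)) \<le> r"
  proof -
    have "\<phi> G0_c (\<phi> G0_c p) = \<phi> (inv\<^bsub>G0\<^esub> ?t \<otimes>\<^bsub>G0\<^esub> G0_y) p"
      using \<phi>m[of G0_c G0_c p] p by (simp add: G0_c_square)
    also have "\<dots> = \<phi> (inv\<^bsub>G0\<^esub> ?t) p"
      using \<phi>m[of "inv\<^bsub>G0\<^esub> ?t" G0_y p] p t \<phi>y by (simp add: G0_y_closed)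
    finally have cc: "\<phi> G0_c (\<phi> G0_c p) = \<phi> (inv\<^bsub>G0\<^esub> ?t) p" .
    have "\<phi> ?t (\<phi> (inv\<^bsub>G0\<^esub> ?t) p) = p"
      using \<phi>m[of ?t "inv\<^bsub>G0\<^esub> ?t" p] p t by (simp add: act.id_eq_one[symmetric])
    then have "d p (\<phi> (inv\<^bsub>G0\<^esub> ?t) p) = d (\<phi> ?t p) p"
      using \<phi>d[OF t p \<phi>X[of "inv\<^bsub>G0\<^esub> ?t" p]] p t by simp
    then show ?thesis using ae commute cc by simp
  qed
  obtain g where g: "g \<in> carrier G0" "G0_c = g \<otimes>\<^bsub>G0\<^esub> G0_a \<otimes>\<^bsub>G0\<^esub> inv\<^bsub>G0\<^esub> g"
    by (rule G0_c_conjugate_a)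
  have cg: "\<phi> G0_c (\<phi> g x) = \<phi> g (\<phi> G0_a x)" if "x \<in> X" for x
  proof -
    have "G0_c \<otimes>\<^bsub>G0\<^esub> g = g \<otimes>\<^bsub>G0\<^esub> G0_a"
      unfolding g(2) using g(1) by (simp add: G0.m_assoc)
    then show ?thesis using \<phi>m[of G0_c g x] \<phi>m[of g G0_a x] that g(1) by simp
  qed
  have an: "(\<phi> G0_a ^^ n) q \<in> X" for n by (induction n) (use q \<phi>X in auto)
  \<comment> \<open>\<open>g\<close> carries the orbit of \<open>q\<close> on the axis of
    \<open>a\<close> to an orbit on an axis of \<open>c\<close>.\<close>
  have cn: "(\<phi> G0_c ^^ n) (\<phi> g q) = \<phi> g ((\<phi> G0_a ^^ n) q)" for n
    by (induction n) (simp_all add: cg an)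
  define q' where "q' = \<phi> g q"
  have q': "q' \<in> X" using q g \<phi>X by (simp add: q'_def)
  have cq: "d q' ((\<phi> G0_c ^^ n) q') = r * n" for n
    unfolding q'_def cn using \<phi>d[OF g(1) q an] axis by simp
  have cX: "(\<phi> G0_c ^^ n) x \<in> X" if "x \<in> X" for n x by (induction n) (use that \<phi>X in auto)
  have cd: "d ((\<phi> G0_c ^^ n) x) ((\<phi> G0_c ^^ n) y) = d x y" if "x \<in> X" "y \<in> X" for n x y
    by (induction n) (use that \<phi>d cX in auto)
  \<comment> \<open>The exact displacement \<open>2 n r\<close> of \<open>q'\<close> is compared
    with the detour through \<open>p\<close> and its image, of length at most
    \<open>2 * d p q' + n r\<close>.\<close>
  have "r * n \<le> 2 * d p q'" for n :: nat
  proof -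
    let ?c = "\<phi> G0_c ^^ (2 * n)"
    have "d p (((\<phi> G0_c ^^ 2) ^^ n) p) \<le> n * d p ((\<phi> G0_c ^^ 2) p)"
    proof (rule funpow_displacement_le[OF Metric_space_axioms])
      show "(\<phi> G0_c ^^ 2) ` X \<subseteq> X" using cX by (rule image_subsetI)
    qed (use cd p in simp_all)
    then have "d p (?c p) \<le> n * d p ((\<phi> G0_c ^^ 2) p)" by (simp add: funpow_mult)
    also have "\<dots> \<le> n * r" using cc by (intro mult_left_mono) (auto simp: numeral_2_eq_2)
    finally have 1: "d p (?c p) \<le> n * r" .
    have 2: "d q' (?c q') \<le> d q' p + d p (?c q')" by (rule triangle) (use p q' cX in auto)
    have 3: "d p (?c q') \<le> d p (?c p) + d (?c p) (?c q')" by (rule triangle) (use p q' cX in auto)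
    show ?thesis
      using 1 2 3 cq[of "2 * n"] cd[OF p q', of "2 * n"] commute[of q' p] by (simp add: algebra_simps)
  qed
  moreover obtain n :: nat where "2 * d p q' / r < n" using reals_Archimedean2 by blast
  ultimately show False using r by (metis (no_types, lifting) mult.commute not_less pos_divide_less_eq)
qed

end
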